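(* Let $c\in\mathbb{R}$ and $T>0$. A function $\varphi\in X^2_c$ belongs to the Paley--Wiener space $B^2_{c,T}$ if and only if there exists a function $f\in\mathscr{B}^2_{c,T}$ (the Mellin--Bernstein space) such that $f(\cdot,0)=\varphi(\cdot)$ on $\mathbb{R}^+$.
   Context: $\mathbb{R}^+=\,]0,\infty[$ and $\mathbb{H}:=\{(r,\theta): r\in\mathbb{R}^+,\ \theta\in\mathbb{R}\}$. For $c\in\mathbb{R}$ and $1\le p<\infty$, $X^p_c$ is the space of measurable functions $\varphi:\mathbb{R}^+\to\mathbb{C}$ with $\|\varphi\|_{X^p_c}:=\left(\int_0^\infty|\varphi(r)|^p r^{cp-1}\,dr\right)^{1/p}<\infty$. Mellin transform on $X^2_c$: for $\varphi\in X^2_c$, $[\varphi]^\wedge_{M^2_c}(c+it)$ (as a function of $t\in\mathbb{R}$) is the limit in $L^2(\mathbb{R})$, as $\rho\to+\infty$, of the functions $t\mapsto\int_{1/\rho}^{\rho}\varphi(u)u^{c+it-1}\,du$. Paley--Wiener space: $B^2_{c,T}$ is the set of all $\varphi\in X^2_c\cap C(\mathbb{R}^+)$ (continuous functions) such that $[\varphi]^\wedge_{M^2_c}(c+it)=0$ for almost all $t$ with $|t|>T$. Polar-analytic: a function $f:\mathcal{D}\to\mathbb{C}$ on a domain $\mathcal{D}\subset\mathbb{H}$ is polar-analytic on $\mathcal{D}$ if for every $(r_0,\theta_0)\in\mathcal{D}$ the limit $$\lim_{(r,\theta)\to(r_0,\theta_0)}\frac{f(r,\theta)-f(r_0,\theta_0)}{re^{i\theta}-r_0e^{i\theta_0}}$$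 exists in $\mathbb{C}$, independently of how $(r,\theta)$ approaches $(r_0,\theta_0)$ within $\mathcal{D}$. Mellin--Bernstein space: for $c\in\mathbb{R}$, $T>0$, $p\in[1,\infty[$, $\mathscr{B}^p_{c,T}$ is the set of all functions $f:\mathbb{H}\to\mathbb{C}$ such that (i) $f$ is polar-analytic on $\mathbb{H}$; (ii) $f(\cdot,0)\in X^p_c$; (iii) there is a constant $C_f>0$ with $|f(r,\theta)|\le C_f r^{-c}e^{T|\theta|}$ for all $(r,\theta)\in\mathbb{H}$. *)

theory Defs
  imports "HOL-Analysis.Analysis"
begin

text \<open>
  Functions on the positive half-line are total functions on the reals of which only the values
  on \<open>{0<..}\<close> are ever inspected; likewise functions on \<open>polar_plane\<close>. Measurability is with
  respect to Lebesgue measure, and elements of \<open>mellin_space p c\<close> are functions, not classes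
  modulo null sets. The exponent is meant to satisfy \<open>1 \<le> p\<close>.
\<close>

definition mellin_space :: "real \<Rightarrow> real \<Rightarrow> (real \<Rightarrow> complex) set" where
  "mellin_space p c =
     {\<phi>. \<phi> \<in> borel_measurable (lebesgue_on {0<..}) \<and>
         (\<integral>\<^sup>+ r. ennreal (norm (\<phi> r) powr p * r powr (c * p - 1)) \<partial>lebesgue_on {0<..}) < \<infinity>}"

definition truncated_mellin :: "real \<Rightarrow> (real \<Rightarrow> complex) \<Rightarrow> real \<Rightarrow> real \<Rightarrow> complex" where
  "truncated_mellin c \<phi> \<rho> t =
     (LINT u:{1/\<rho>..\<rho>}|lebesgue. \<phi> u * complex_of_real u powr (Complex c t - 1))"

text \<open>
  \<open>has_mellin_transform c \<phi> g\<close>: the function \<open>g\<close> represents \<open>t \<mapsto> [\<phi>]^(c + i t)\<close>, the limit of the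
  truncated transforms in \<open>L\<^sup>2\<close> of the real line. It is a relation because such a limit is
  determined only up to a null set.
\<close>

definition has_mellin_transform ::
  "real \<Rightarrow> (real \<Rightarrow> complex) \<Rightarrow> (real \<Rightarrow> complex) \<Rightarrow> bool" where
  "has_mellin_transform c \<phi> g \<longleftrightarrow>
     g \<in> borel_measurable lebesgue \<and>
     (\<integral>\<^sup>+ t. ennreal ((norm (g t))\<^sup>2) \<partial>lebesgue) < \<infinity> \<and>
     ((\<lambda>\<rho>. \<integral>\<^sup>+ t. ennreal ((norm (truncated_mellin c \<phi> \<rho> t - g t))\<^sup>2) \<partial>lebesgue) \<longlongrightarrow> 0) at_top"

definition paley_wiener_space :: "real \<Rightarrow> real \<Rightarrow> (real \<Rightarrow> complex) set" where
  "paley_wiener_space c T =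
     {\<phi> \<in> mellin_space 2 c. continuous_on {0<..} \<phi> \<and>
        (\<exists>g. has_mellin_transform c \<phi> g \<and> (AE t in lebesgue. \<bar>t\<bar> > T \<longrightarrow> g t = 0))}"

definition polar_plane :: "(real \<times> real) set" where
  "polar_plane = {0<..} \<times> UNIV"

text \<open>
  The denominator vanishes also at points whose angle differs by a nonzero multiple of \<open>2\<pi>\<close>,
  but never in a small punctured neighbourhood of the base point, so division by zero does not
  affect the limit.
\<close>

definition polar_analytic_on :: "(real \<times> real \<Rightarrow> complex) \<Rightarrow> (real \<times> real) set \<Rightarrow> bool" where
  "polar_analytic_on f D \<longleftrightarrow>
     (\<forall>(r0, \<theta>0)\<in>D. \<exists>L.
        ((\<lambda>(r, \<theta>). (f (r, \<theta>) - f (r0, \<theta>0)) / (rcis r \<theta> - rcis r0 \<theta>0)) \<longlongrightarrow> L)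
          (at (r0, \<theta>0) within D))"

definition mellin_bernstein_space ::
  "real \<Rightarrow> real \<Rightarrow> real \<Rightarrow> (real \<times> real \<Rightarrow> complex) set" where
  "mellin_bernstein_space p c T =
     {f. polar_analytic_on f polar_plane \<and>
         (\<lambda>r. f (r, 0)) \<in> mellin_space p c \<and>
         (\<exists>C>0. \<forall>(r, \<theta>)\<in>polar_plane.
            norm (f (r, \<theta>)) \<le> C * r powr (- c) * exp (T * \<bar>\<theta>\<bar>))}"

end

theory Submission
  imports Defs "HOL-Probability.Probability" "HOL-Complex_Analysis.Complex_Analysis"
    "HOL-Real_Asymp.Real_Asymp"
begin

text \<open>
  The substitution \<open>u = e\<^sup>x\<close> with \<open>h x = e\<^bsup>cx\<^esup> \<phi>(e\<^sup>x)\<close> turns the Mellin transform on the line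
  \<open>c + i t\<close> into the Fourier transform of \<open>h\<close>, and polar-analytic functions on the polar plane into
  entire functions, so the claim becomes the classical Paley--Wiener theorem.

  If the transform \<open>g\<close> of \<open>h\<close> lives on \<open>[-T, T]\<close>, it is integrable, and Fourier inversion
  (by Gaussian summation) shows that \<open>h\<close> is the restriction of the entire function
  \<open>z \<mapsto> (1/2\<pi>) \<integral> g(t) e\<^bsup>-itz\<^esup> dt\<close>.
  Conversely, if \<open>h\<close> extends to an entire \<open>G\<close> with \<open>|G z| \<le> C e\<^bsup>T|Im z|\<^esup>\<close>, then for \<open>t > T\<close>
  closing the contour in the upper half-plane shows that the transform of
  \<open>G(x) / (1 - i \<epsilon> x)\<^sup>2\<close> vanishes at \<open>t\<close>; letting \<open>\<epsilon> \<rightarrow> 0\<close> in \<open>L\<^sup>2\<close> gives \<open>g t = 0\<close>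
  for almost all such \<open>t\<close>, and \<open>t < -T\<close> follows by reflection. Only the inequality in
  Plancherel's theorem is needed.
\<close>

section \<open>The Fourier transform of integrable functions\<close>

text \<open>Sign and normalisation follow the Mellin kernel: at \<open>u = exp x\<close> the power
  of \<open>u\<close> with exponent \<open>i t\<close> is \<open>cis (t * x)\<close>, with no
  constant in front. The price is a factor \<open>2 * pi\<close> in Plancherel's inequality and in
  the inversion formula.\<close>

definition fourier :: "(real \<Rightarrow> complex) \<Rightarrow> real \<Rightarrow> complex" where
  "fourier f t = (LINT x|lborel. f x * cis (t * x))"

lemma borel_measurable_cis [measurable (raw)]:
  "f \<in> borel_measurable M \<Longrightarrow> (\<lambda>x. cis (f x)) \<in> borel_measurable M"
  unfolding cis_conv_exp by measurable

lemma integrable_mult_cis: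
  fixes f :: "real \<Rightarrow> complex"
  assumes "integrable lborel f" "g \<in> borel_measurable lborel"
  shows "integrable lborel (\<lambda>x. f x * cis (g x))"
  by (rule Bochner_Integration.integrable_bound [OF assms(1)]) (use assms in \<open>auto simp: norm_mult\<close>)

lemma borel_measurable_fourier:
  assumes "integrable lborel f"
  shows "fourier f \<in> borel_measurable borel"
proof -
  have [measurable]: "f \<in> borel_measurable borel" using assms by auto
  show ?thesis unfolding fourier_def by measurable
qed

lemma norm_fourier_le:
  assumes "integrable lborel f"
  shows "norm (fourier f t) \<le> (LINT x|lborel. norm (f x))"
proof -
  have "norm (fourier f t) \<le> (LINT x|lborel. norm (f x * cis (t * x)))"
    unfolding fourier_def by (rule integral_norm_bound)
  then show ?thesis by (simp add: norm_mult)
qed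

lemma fourier_diff:
  assumes "integrable lborel f" "integrable lborel g"
  shows "fourier (\<lambda>x. f x - g x) t = fourier f t - fourier g t"
  using assms unfolding fourier_def
  by (simp add: left_diff_distrib Bochner_Integration.integral_diff integrable_mult_cis)

text \<open>The characteristic function of the standard normal law is a Gaussian, and rescaling by
  \<open>s\<close> gives the stated transform. A weight of width \<open>1 / s\<close> thus becomes a
  probability density of standard deviation \<open>s\<close>, which concentrates at 0 as
  \<open>s\<close> tends to 0.\<close>

lemma fourier_gaussian:
  assumes s: "s > 0"
  shows "integrable lborel (\<lambda>t. complex_of_real (exp (- (s * t)\<^sup>2 / 2)))"
    and "fourier (\<lambda>t. complex_of_real (exp (- (s * t)\<^sup>2 / 2))) u
           = complex_of_real (2 * pi * normal_density 0 s u)"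
proof -
  have dens: "exp (- (s * t)\<^sup>2 / 2) = sqrt (2 * pi) * std_normal_density (s * t)" for t
    by (simp add: std_normal_density_def)
  have "integrable lborel (\<lambda>t. sqrt (2 * pi) * std_normal_density (0 + s * t))"
    by (intro integrable_mult_right lborel_integrable_real_affine) (use s in auto)
  then show int: "integrable lborel (\<lambda>t. complex_of_real (exp (- (s * t)\<^sup>2 / 2)))"
    unfolding dens by simp
  have "complex_of_real (exp (- ((u / s)^2) / 2)) = char std_normal_distribution (u / s)"
    by (simp add: char_std_normal_distribution)
  also have "\<dots> = (LINT x|lborel. std_normal_density x *\<^sub>R iexp (u / s * x))"
    unfolding char_def by (subst integral_density) auto
  also have "\<dots> = s *\<^sub>R (LINT x|lborel. std_normal_density (0 + s * x) *\<^sub>R iexp (u / s * (0 + s * x)))"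
    by (subst lborel_integral_real_affine [where c = s and t = 0]) (use s in auto)
  also have "(\<lambda>x. std_normal_density (0 + s * x) *\<^sub>R iexp (u / s * (0 + s * x)))
     = (\<lambda>x. complex_of_real (1 / sqrt (2 * pi)) * (complex_of_real (exp (- (s * x)\<^sup>2 / 2)) * cis (u * x)))"
    using s by (auto simp: std_normal_density_def cis_conv_exp scaleR_conv_of_real)
  finally have "complex_of_real (exp (- ((u / s)^2) / 2))
     = s *\<^sub>R (complex_of_real (1 / sqrt (2 * pi)) * fourier (\<lambda>t. complex_of_real (exp (- (s * t)\<^sup>2 / 2))) u)"
    unfolding fourier_def by simp
  then have "fourier (\<lambda>t. complex_of_real (exp (- (s * t)\<^sup>2 / 2))) u
     = complex_of_real (sqrt (2 * pi) / s * exp (- ((u / s)^2) / 2))"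
    using s by (simp add: scaleR_conv_of_real field_simps)
  also have "sqrt (2 * pi) / s * exp (- ((u / s)^2) / 2) = 2 * pi * normal_density 0 s u"
    using s by (simp add: normal_density_def real_sqrt_mult real_div_sqrt power_divide field_simps)
  finally show "fourier (\<lambda>t. complex_of_real (exp (- (s * t)\<^sup>2 / 2))) u
     = complex_of_real (2 * pi * normal_density 0 s u)" .
qed

text \<open>Supplies the integrability on the plane behind the applications of Fubini's theorem with
  a Gaussian weight; the bounded kernel \<open>h\<close> carries the oscillating factor.\<close>

lemma integrable_pair_mult:
  fixes f g :: "real \<Rightarrow> complex"
  assumes f: "integrable lborel f" and g: "integrable lborel g"
    and h: "h \<in> borel_measurable (lborel \<Otimes>\<^sub>M lborel)" "\<And>p. norm (h p :: complex) \<le> B"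
  shows "integrable (lborel \<Otimes>\<^sub>M lborel) (\<lambda>(x, y). f x * g y * h (x, y))"
proof -
  have [measurable]: "f \<in> borel_measurable borel" "g \<in> borel_measurable borel" using f g by auto
  note h(1) [measurable]
  have "integrable (lborel \<Otimes>\<^sub>M lborel) (\<lambda>(x, y). f x * g y)"
  proof (rule lborel_pair.Fubini_integrable)
    show "integrable lborel (\<lambda>x. LINT y|lborel. norm (case (x, y) of (x, y) \<Rightarrow> f x * g y))"
      using f by (simp add: norm_mult)
  qed (use g in auto)
  then have "integrable (lborel \<Otimes>\<^sub>M lborel) (\<lambda>p. of_real B * (case p of (x, y) \<Rightarrow> f x * g y))"
    by (rule integrable_mult_right)
  then show ?thesis
  proof (rule Bochner_Integration.integrable_bound)
    have "norm (f x * g y * h (x, y)) \<le> norm (of_real B * (f x * g y))" for x y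
    proof -
      have "norm (h (x, y)) \<le> \<bar>B\<bar>" using h(2) [of "(x, y)"] by linarith
      then have "norm (f x * g y) * norm (h (x, y)) \<le> norm (f x * g y) * \<bar>B\<bar>"
        by (rule mult_left_mono) simp
      then show ?thesis by (simp add: norm_mult mult_ac)
    qed
    then show "AE p in lborel \<Otimes>\<^sub>M lborel. norm (case p of (x, y) \<Rightarrow> f x * g y * h (x, y))
            \<le> norm (of_real B * (case p of (x, y) \<Rightarrow> f x * g y))"
      by (auto simp: split_beta intro!: AE_I2)
  qed measurable
qed

text \<open>After Fubini the inner integral over \<open>t\<close> is the transform of the Gaussian
  at \<open>y - x\<close>, which is \<open>2 * pi\<close> times a normal density. Inversion with a
  Gaussian weight therefore returns \<open>f\<close> smoothed by that density.\<close>

lemma fourier_gaussian_inversion: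
  assumes f: "integrable lborel f" and s: "s > 0"
  shows "(LINT t|lborel. fourier f t * cis (- (t * x)) * complex_of_real (exp (- (s * t)\<^sup>2 / 2)))
     = 2 * pi * (LINT y|lborel. f y * complex_of_real (normal_density x s y))"
proof -
  define w where "w t = complex_of_real (exp (- (s * t)\<^sup>2 / 2))" for t
  have w: "integrable lborel w" unfolding w_def by (rule fourier_gaussian(1) [OF s])
  have [measurable]: "f \<in> borel_measurable borel" "w \<in> borel_measurable borel" using f w by auto
  have *: "integrable (lborel \<Otimes>\<^sub>M lborel) (\<lambda>(t, y). w t * f y * cis (t * (y - x)))"
    using integrable_pair_mult [OF w f, where h = "\<lambda>(t, y). cis (t * (y - x))" and B = 1]
    by (auto simp: split_beta')
  have "(LINT t|lborel. fourier f t * cis (- (t * x)) * w t)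
      = (LINT t|lborel. LINT y|lborel. w t * f y * cis (t * (y - x)))"
  proof (intro Bochner_Integration.integral_cong refl)
    fix t
    have "w t * f y * cis (t * (y - x)) = (w t * cis (- (t * x))) * (f y * cis (t * y))" for y
      by (simp add: right_diff_distrib cis_divide [symmetric] cis_inverse [symmetric] divide_inverse del: cis_inverse)
    then have "(LINT y|lborel. w t * f y * cis (t * (y - x))) = w t * cis (- (t * x)) * fourier f t"
      unfolding fourier_def by (simp only: integral_mult_right_zero)
    then show "fourier f t * cis (- (t * x)) * w t = (LINT y|lborel. w t * f y * cis (t * (y - x)))"
      by (simp only: mult_ac)
  qed
  also have "\<dots> = (LINT y|lborel. LINT t|lborel. w t * f y * cis (t * (y - x)))"
    using lborel_pair.Fubini_integral [OF *] by simp
  also have "\<dots> = (LINT y|lborel. f y * fourier w (y - x))"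
    unfolding fourier_def
    by (simp flip: integral_mult_right_zero add: mult_ac)
  also have "\<dots> = (LINT y|lborel. 2 * pi * (f y * complex_of_real (normal_density x s y)))"
    unfolding w_def fourier_gaussian(2) [OF s]
    by (intro Bochner_Integration.integral_cong refl) (simp add: normal_density_def mult_ac)
  finally show ?thesis unfolding w_def by simp
qed

section \<open>Plancherel's inequality by Gaussian weights\<close>

lemma nn_integral_normal_density:
  assumes "s > 0"
  shows "(\<integral>\<^sup>+ y. ennreal (normal_density x s y) \<partial>lborel) = 1"
  using assms by (subst nn_integral_eq_integral) auto

text \<open>A function that is not integrable has Bochner integral 0, so the estimate covers it as
  well.\<close>

lemma norm_integral_le_nn_integral:
  fixes f :: "'a \<Rightarrow> 'b :: {banach, second_countable_topology}"
  shows "ennreal (norm (integral\<^sup>L M f)) \<le> (\<integral>\<^sup>+ x. ennreal (norm (f x)) \<partial>M)"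
  by (cases "integrable M f") (auto simp: integral_norm_bound_ennreal not_integrable_integral_eq)

text \<open>In \<open>w * fourier f * cnj (fourier f)\<close> only the conjugate factor is unfolded
  into an integral. Fubini and the weighted inversion formula then produce a quadratic form in
  \<open>f\<close> whose kernel is the normal density, and Schur's test bounds it because each row
  and column of the symmetric kernel has mass 1.\<close>

lemma plancherel_gaussian:
  assumes f: "integrable lborel f" and s: "s > 0"
  shows "(\<integral>\<^sup>+ t. ennreal ((norm (fourier f t))\<^sup>2 * exp (- (s * t)\<^sup>2 / 2)) \<partial>lborel)
     \<le> ennreal (2 * pi) * (\<integral>\<^sup>+ x. ennreal ((norm (f x))\<^sup>2) \<partial>lborel)"
proof -
  define w where "w t = complex_of_real (exp (- (s * t)\<^sup>2 / 2))" for t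
  have w: "integrable lborel w" unfolding w_def by (rule fourier_gaussian(1) [OF s])
  have [measurable]: "f \<in> borel_measurable borel" "w \<in> borel_measurable borel"
    "fourier f \<in> borel_measurable borel" using f w borel_measurable_fourier by auto
  define B where "B = (LINT x|lborel. norm (f x))"
  have bnd: "norm (fourier f t) \<le> B" for t unfolding B_def by (rule norm_fourier_le [OF f])
  have B0: "0 \<le> B" unfolding B_def by simp
  have cf: "integrable lborel (\<lambda>x. cnj (f x))" using f by simp
  have *: "integrable (lborel \<Otimes>\<^sub>M lborel) (\<lambda>(t, x). w t * cnj (f x) * (fourier f t * cis (- (t * x))))"
    using integrable_pair_mult [OF w cf, where h = "\<lambda>(t, x). fourier f t * cis (- (t * x))" and B = B] bnd
    by (auto simp: split_beta' norm_mult)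
  have int: "integrable lborel (\<lambda>t. (norm (fourier f t))\<^sup>2 * exp (- (s * t)\<^sup>2 / 2))"
  proof (rule Bochner_Integration.integrable_bound)
    show "integrable lborel (\<lambda>t. complex_of_real (B\<^sup>2) * w t)" using w by (rule integrable_mult_right)
    show "AE t in lborel. norm ((norm (fourier f t))\<^sup>2 * exp (- (s * t)\<^sup>2 / 2)) \<le> norm (complex_of_real (B\<^sup>2) * w t)"
      using bnd by (auto simp: w_def norm_mult norm_power intro!: mult_right_mono power_mono)
  qed measurable
  have "complex_of_real (LINT t|lborel. (norm (fourier f t))\<^sup>2 * exp (- (s * t)\<^sup>2 / 2))
      = (LINT t|lborel. complex_of_real ((norm (fourier f t))\<^sup>2 * exp (- (s * t)\<^sup>2 / 2)))"
    by (simp only: integral_complex_of_real)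
  also have "\<dots> = (LINT t|lborel. LINT x|lborel. w t * cnj (f x) * (fourier f t * cis (- (t * x))))"
  proof (intro Bochner_Integration.integral_cong refl)
    fix t
    have "complex_of_real ((norm (fourier f t))\<^sup>2 * exp (- (s * t)\<^sup>2 / 2)) = w t * fourier f t * cnj (fourier f t)"
      unfolding w_def of_real_mult complex_norm_square by (simp add: mult_ac)
    also have "cnj (fourier f t) = (LINT x|lborel. cnj (f x) * cis (- (t * x)))"
      unfolding fourier_def by (simp add: cis_cnj flip: Bochner_Integration.integral_cnj)
    also have "w t * fourier f t * \<dots> = (LINT x|lborel. w t * fourier f t * (cnj (f x) * cis (- (t * x))))"
      by (rule integral_mult_right_zero [symmetric])
    finally show "complex_of_real ((norm (fourier f t))\<^sup>2 * exp (- (s * t)\<^sup>2 / 2))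
        = (LINT x|lborel. w t * cnj (f x) * (fourier f t * cis (- (t * x))))"
      by (simp only: mult_ac)
  qed
  also have "\<dots> = (LINT x|lborel. LINT t|lborel. w t * cnj (f x) * (fourier f t * cis (- (t * x))))"
    using lborel_pair.Fubini_integral [OF *] by simp
  also have "\<dots> = (LINT x|lborel. cnj (f x) * (LINT t|lborel. fourier f t * cis (- (t * x)) * w t))"
    by (simp flip: integral_mult_right_zero add: mult_ac)
  also have "\<dots> = (LINT x|lborel. LINT y|lborel. 2 * pi * cnj (f x) * f y * normal_density x s y)"
    unfolding w_def fourier_gaussian_inversion [OF f s]
    by (simp flip: integral_mult_right_zero add: mult_ac)
  finally have eq: "complex_of_real (LINT t|lborel. (norm (fourier f t))\<^sup>2 * exp (- (s * t)\<^sup>2 / 2)) = \<dots>" .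
  let ?I = "\<integral>\<^sup>+ x. ennreal ((norm (f x))\<^sup>2) \<partial>lborel"
  have sym: "normal_density x s y = normal_density y s x" for x y
    by (simp add: normal_density_def power2_commute)
  have "(\<integral>\<^sup>+ t. ennreal ((norm (fourier f t))\<^sup>2 * exp (- (s * t)\<^sup>2 / 2)) \<partial>lborel)
     = ennreal (LINT t|lborel. (norm (fourier f t))\<^sup>2 * exp (- (s * t)\<^sup>2 / 2))"
    by (rule nn_integral_eq_integral [OF int]) auto
  also have "\<dots> = ennreal (norm (LINT x|lborel. LINT y|lborel. 2 * pi * cnj (f x) * f y * normal_density x s y))"
    by (subst eq [symmetric]) (simp add: norm_of_real)
  also have "\<dots> \<le> (\<integral>\<^sup>+x. norm (LINT y|lborel. 2 * pi * cnj (f x) * f y * normal_density x s y) \<partial>lborel)"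
    by (rule norm_integral_le_nn_integral)
  also have "\<dots> \<le> (\<integral>\<^sup>+x. \<integral>\<^sup>+y. norm (2 * pi * cnj (f x) * f y * normal_density x s y) \<partial>lborel \<partial>lborel)"
    by (intro nn_integral_mono norm_integral_le_nn_integral)
  \<comment> \<open>The inequality \<open>2 a b <= a^2 + b^2\<close> splits the quadratic form into
    two terms. In the second the density is rewritten as centred at \<open>y\<close>, so that after
    swapping the integrals its integral over \<open>x\<close> is 1.\<close>
  also have "\<dots> \<le> (\<integral>\<^sup>+x. \<integral>\<^sup>+y. ennreal (pi * (norm (f x))\<^sup>2) * ennreal (normal_density x s y)
        + ennreal (pi * (norm (f y))\<^sup>2) * ennreal (normal_density y s x) \<partial>lborel \<partial>lborel)"
  proof (intro nn_integral_mono)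
    fix x y
    have "2 * norm (f x) * norm (f y) \<le> (norm (f x))\<^sup>2 + (norm (f y))\<^sup>2"
      by (rule sum_squares_bound)
    then have "2 * norm (f x) * norm (f y) * (pi * normal_density x s y)
        \<le> ((norm (f x))\<^sup>2 + (norm (f y))\<^sup>2) * (pi * normal_density x s y)"
      by (rule mult_right_mono) auto
    then have "norm (2 * pi * cnj (f x) * f y * normal_density x s y)
        \<le> pi * (norm (f x))\<^sup>2 * normal_density x s y + pi * (norm (f y))\<^sup>2 * normal_density y s x"
      by (simp add: norm_mult sym [of y x] algebra_simps)
    then show "ennreal (norm (2 * pi * cnj (f x) * f y * normal_density x s y))
        \<le> ennreal (pi * (norm (f x))\<^sup>2) * ennreal (normal_density x s y)
        + ennreal (pi * (norm (f y))\<^sup>2) * ennreal (normal_density y s x)"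
      by (simp flip: ennreal_mult' ennreal_plus)
  qed
  also have "\<dots> = (\<integral>\<^sup>+x. \<integral>\<^sup>+y. ennreal (pi * (norm (f x))\<^sup>2) * ennreal (normal_density x s y) \<partial>lborel \<partial>lborel)
        + (\<integral>\<^sup>+x. \<integral>\<^sup>+y. ennreal (pi * (norm (f y))\<^sup>2) * ennreal (normal_density y s x) \<partial>lborel \<partial>lborel)"
    unfolding normal_density_def by (simp add: nn_integral_add)
  also have "(\<integral>\<^sup>+x. \<integral>\<^sup>+y. ennreal (pi * (norm (f y))\<^sup>2) * ennreal (normal_density y s x) \<partial>lborel \<partial>lborel)
     = (\<integral>\<^sup>+y. \<integral>\<^sup>+x. ennreal (pi * (norm (f y))\<^sup>2) * ennreal (normal_density y s x) \<partial>lborel \<partial>lborel)"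
    unfolding normal_density_def by (rule lborel_pair.Fubini') measurable
  also have "(\<integral>\<^sup>+x. \<integral>\<^sup>+y. ennreal (pi * (norm (f x))\<^sup>2) * ennreal (normal_density x s y) \<partial>lborel \<partial>lborel)
      = (\<integral>\<^sup>+x. ennreal (pi * (norm (f x))\<^sup>2) \<partial>lborel)"
    by (simp add: nn_integral_cmult nn_integral_normal_density [OF s])
  also have "(\<integral>\<^sup>+x. ennreal (pi * (norm (f x))\<^sup>2) \<partial>lborel) = ennreal pi * ?I"
    by (simp add: ennreal_mult' nn_integral_cmult)
  also have "ennreal pi * ?I + ennreal pi * ?I = ennreal (2 * pi) * ?I"
    using ennreal_plus [of pi pi] by (simp only: mult_2 distrib_right pi_ge_zero)
  finally show ?thesis .
qed

text \<open>The bound of \<open>plancherel_gaussian\<close> is the same for every \<open>s\<close>,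
  so Fatou's lemma applies as the weight tends to 1.\<close>

theorem plancherel_le:
  assumes f: "integrable lborel f"
  shows "(\<integral>\<^sup>+ t. ennreal ((norm (fourier f t))\<^sup>2) \<partial>lborel)
     \<le> ennreal (2 * pi) * (\<integral>\<^sup>+ x. ennreal ((norm (f x))\<^sup>2) \<partial>lborel)"
proof -
  have [measurable]: "fourier f \<in> borel_measurable borel" by (rule borel_measurable_fourier [OF f])
  let ?g = "\<lambda>n t. ennreal ((norm (fourier f t))\<^sup>2 * exp (- (inverse (Suc n) * t)\<^sup>2 / 2))"
  \<comment> \<open>The limit is written with \<open>0 * t\<close> so that it has the shape of the
    approximants, with \<open>inverse (Suc n)\<close> replaced by its limit.\<close>
  have lim: "(\<lambda>n. ?g n t) \<longlonglongrightarrow> ennreal ((norm (fourier f t))\<^sup>2 * exp (- (0 * t)\<^sup>2 / 2))" for t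
    by (intro tendsto_intros LIMSEQ_inverse_real_of_nat tendsto_ennrealI) auto
  have "(\<integral>\<^sup>+ t. ennreal ((norm (fourier f t))\<^sup>2) \<partial>lborel) = (\<integral>\<^sup>+ t. liminf (\<lambda>n. ?g n t) \<partial>lborel)"
    using lim_imp_Liminf [OF _ lim] by simp
  also have "\<dots> \<le> liminf (\<lambda>n. \<integral>\<^sup>+ t. ?g n t \<partial>lborel)"
    by (rule nn_integral_liminf) measurable
  also have "\<dots> \<le> ennreal (2 * pi) * (\<integral>\<^sup>+ x. ennreal ((norm (f x))\<^sup>2) \<partial>lborel)"
    by (rule Liminf_le [OF _ always_eventually [OF allI [OF plancherel_gaussian [OF f]]]]) auto
  finally show ?thesis .
qed

section \<open>Square-integrable functions\<close>

text \<open>A substitute for the triangle inequality that stays with squared norms and so avoids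
  square roots in \<open>ennreal\<close>; the factor 2 is harmless where only convergence to 0
  matters.\<close>

lemma nn_integral_norm_add_le:
  fixes f g :: "'a \<Rightarrow> complex"
  assumes [measurable]: "f \<in> borel_measurable M" "g \<in> borel_measurable M"
  shows "(\<integral>\<^sup>+ x. ennreal ((norm (f x + g x))\<^sup>2) \<partial>M)
     \<le> 2 * (\<integral>\<^sup>+ x. ennreal ((norm (f x))\<^sup>2) \<partial>M) + 2 * (\<integral>\<^sup>+ x. ennreal ((norm (g x))\<^sup>2) \<partial>M)"
proof -
  have "(\<integral>\<^sup>+ x. ennreal ((norm (f x + g x))\<^sup>2) \<partial>M)
     \<le> (\<integral>\<^sup>+ x. 2 * ennreal ((norm (f x))\<^sup>2) + 2 * ennreal ((norm (g x))\<^sup>2) \<partial>M)"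
  proof (intro nn_integral_mono)
    fix x
    have "(norm (f x + g x))\<^sup>2 \<le> (norm (f x) + norm (g x))\<^sup>2"
      by (intro power_mono norm_triangle_ineq) auto
    also have "\<dots> \<le> 2 * (norm (f x))\<^sup>2 + 2 * (norm (g x))\<^sup>2"
      using sum_squares_bound [of "norm (f x)" "norm (g x)"] by (simp add: power2_sum)
    finally have "ennreal ((norm (f x + g x))\<^sup>2) \<le> ennreal (2 * (norm (f x))\<^sup>2 + 2 * (norm (g x))\<^sup>2)"
      by (rule ennreal_leI)
    then show "ennreal ((norm (f x + g x))\<^sup>2) \<le> 2 * ennreal ((norm (f x))\<^sup>2) + 2 * ennreal ((norm (g x))\<^sup>2)"
      by (simp add: ennreal_mult')
  qed
  then show ?thesis by (simp add: nn_integral_add nn_integral_cmult)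
qed

lemma nn_integral_norm_diff_le:
  fixes f g k :: "'a \<Rightarrow> complex"
  assumes [measurable]: "f \<in> borel_measurable M" "g \<in> borel_measurable M" "k \<in> borel_measurable M"
  shows "(\<integral>\<^sup>+ x. ennreal ((norm (f x - g x))\<^sup>2) \<partial>M)
     \<le> 2 * (\<integral>\<^sup>+ x. ennreal ((norm (f x - k x))\<^sup>2) \<partial>M) + 2 * (\<integral>\<^sup>+ x. ennreal ((norm (k x - g x))\<^sup>2) \<partial>M)"
  using nn_integral_norm_add_le [of "\<lambda>x. f x - k x" M "\<lambda>x. k x - g x"] by simp

text \<open>The Riesz-Fischer argument with a rate: a rapidly Cauchy subsequence converges almost
  everywhere, and Fatou's lemma hands the Cauchy bound \<open>a R\<close> over to the distance from
  \<open>F R\<close> to the limit.\<close>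

lemma L2_complete:
  fixes F :: "real \<Rightarrow> 'a \<Rightarrow> complex" and a :: "real \<Rightarrow> ennreal"
  assumes [measurable]: "\<And>R. F R \<in> borel_measurable M"
    and le: "\<And>R S. R \<le> S \<Longrightarrow> (\<integral>\<^sup>+ x. ennreal ((norm (F S x - F R x))\<^sup>2) \<partial>M) \<le> a R"
    and a: "(a \<longlongrightarrow> 0) at_top"
  obtains g where "g \<in> borel_measurable M"
    "\<And>R. (\<integral>\<^sup>+ x. ennreal ((norm (F R x - g x))\<^sup>2) \<partial>M) \<le> a R"
proof -
  \<comment> \<open>The ratio \<open>1/4\<close> leaves room for the weight \<open>2 ^ n\<close>
    used below: the weighted series is still bounded by a geometric one of ratio
    \<open>1/2\<close>.\<close>
  have "\<exists>r\<ge>real n. a r < ennreal ((1/4) ^ n)" for n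
  proof -
    have "eventually (\<lambda>r. a r < ennreal ((1/4) ^ n)) at_top"
      by (rule order_tendstoD [OF a]) simp
    then have "eventually (\<lambda>r. r \<ge> real n \<and> a r < ennreal ((1/4) ^ n)) at_top"
      using eventually_ge_at_top by (rule eventually_conj [rotated])
    then show ?thesis using eventually_happens by fastforce
  qed
  then obtain r where r: "\<And>n. r n \<ge> real n" "\<And>n. a (r n) < ennreal ((1/4) ^ n)" by metis
  have sym: "norm (F S x - F R x) = norm (F R x - F S x)" for S R x by (rule norm_minus_commute)
  define d where "d n x = F (r (Suc n)) x - F (r n) x" for n x
  have [measurable]: "d n \<in> borel_measurable M" for n unfolding d_def by measurable
  have dle: "(\<integral>\<^sup>+ x. ennreal ((norm (d n x))\<^sup>2) \<partial>M) \<le> ennreal ((1/4) ^ n)" for n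
  \<comment> \<open>The sequence \<open>r\<close> need not increase. When it steps down, the bound
    is taken at \<open>r (Suc n)\<close>, the smaller of the two radii.\<close>
  proof (cases "r n \<le> r (Suc n)")
    case True
    then show ?thesis unfolding d_def using le [OF True] r(2) [of n] by order
  next
    case False
    then have "(\<integral>\<^sup>+ x. ennreal ((norm (d n x))\<^sup>2) \<partial>M) \<le> a (r (Suc n))"
      unfolding d_def using le [of "r (Suc n)" "r n"] by (subst sym) simp
    also have "\<dots> \<le> ennreal ((1/4) ^ Suc n)" using r(2) by (rule less_imp_le)
    also have "\<dots> \<le> ennreal ((1/4) ^ n)" by (intro ennreal_leI) simp
    finally show ?thesis .
  qed
  have "(\<integral>\<^sup>+ x. (\<Sum>n. ennreal (2 ^ n * (norm (d n x))\<^sup>2)) \<partial>M)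
      = (\<Sum>n. \<integral>\<^sup>+ x. ennreal (2 ^ n * (norm (d n x))\<^sup>2) \<partial>M)"
    by (rule nn_integral_suminf) measurable
  also have "\<dots> = (\<Sum>n. ennreal (2 ^ n) * (\<integral>\<^sup>+ x. ennreal ((norm (d n x))\<^sup>2) \<partial>M))"
    by (simp add: ennreal_mult' nn_integral_cmult)
  also have "\<dots> \<le> (\<Sum>n. ennreal ((1/2) ^ n))"
  proof (intro suminf_le allI)
    fix n :: nat
    have "ennreal (2 ^ n) * (\<integral>\<^sup>+ x. ennreal ((norm (d n x))\<^sup>2) \<partial>M) \<le> ennreal (2 ^ n) * ennreal ((1/4) ^ n)"
      by (intro mult_left_mono dle) auto
    also have "\<dots> = ennreal (2 ^ n * (1/4) ^ n)" by (simp add: ennreal_mult')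
    also have "2 ^ n * (1/4) ^ n = (1/2 :: real) ^ n" by (simp flip: power_mult_distrib)
    finally show "ennreal (2 ^ n) * (\<integral>\<^sup>+ x. ennreal ((norm (d n x))\<^sup>2) \<partial>M) \<le> ennreal ((1/2) ^ n)" .
  qed auto
  also have "\<dots> < \<infinity>"
    by (subst suminf_ennreal2) (auto intro: summable_geometric)
  finally have "AE x in M. (\<Sum>n. ennreal (2 ^ n * (norm (d n x))\<^sup>2)) \<noteq> \<infinity>"
    by (intro nn_integral_PInf_AE) auto
  then have conv: "AE x in M. convergent (\<lambda>n. F (r n) x)"
  proof eventually_elim
    case (elim x)
    then have "summable (\<lambda>n. 2 ^ n * (norm (d n x))\<^sup>2)"
      by (intro summable_suminf_not_top) auto
    then have "summable (\<lambda>n. 2 ^ n * (norm (d n x))\<^sup>2 + (1/2) ^ n)"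
      by (intro summable_add summable_geometric) auto
    then have "summable (\<lambda>n. d n x)"
    proof (rule summable_comparison_test' [where N = 0])
      fix n :: nat
      \<comment> \<open>The arithmetic-geometric mean inequality, in the form
        \<open>2 d <= 2^n d^2 + 2^(-n)\<close>, trades weighted square summability for absolute
        summability.\<close>
      have "norm (d n x) \<le> 2 ^ n * (norm (d n x))\<^sup>2 + (1/2) ^ n"
      proof -
        have "0 \<le> (2 ^ n * norm (d n x) - 1)\<^sup>2" by simp
        then have "2 * (2 ^ n * norm (d n x)) \<le> 2 ^ n * (2 ^ n * (norm (d n x))\<^sup>2) + 1"
          by (simp add: power2_eq_square algebra_simps)
        then have "2 ^ n * (2 * norm (d n x)) \<le> 2 ^ n * (2 ^ n * (norm (d n x))\<^sup>2 + (1/2) ^ n)"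
          by (simp add: distrib_left mult_ac flip: power_mult_distrib)
        then have "2 * norm (d n x) \<le> 2 ^ n * (norm (d n x))\<^sup>2 + (1/2) ^ n"
          by (rule mult_left_le_imp_le) auto
        then show ?thesis using norm_ge_zero [of "d n x"] by linarith
      qed
      then show "norm (d n x) \<le> 2 ^ n * (norm (d n x))\<^sup>2 + (1/2) ^ n" .
    qed
    then have "convergent (\<lambda>n. \<Sum>i<n. d i x)" by (simp add: summable_iff_convergent)
    then have "convergent (\<lambda>n. F (r 0) x + (\<Sum>i<n. d i x))" by (intro convergent_add convergent_const)
    also have "(\<lambda>n. F (r 0) x + (\<Sum>i<n. d i x)) = (\<lambda>n. F (r n) x)"
      unfolding d_def using sum_lessThan_telescope [of "\<lambda>i. F (r i) x"] by simp
    finally show ?case .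
  qed
  define g where "g x = lim (\<lambda>n. F (r n) x)" for x
  show ?thesis
  proof
    show [measurable]: "g \<in> borel_measurable M" unfolding g_def by measurable
    fix R
    have "AE x in M. ennreal ((norm (F R x - g x))\<^sup>2) = liminf (\<lambda>n. ennreal ((norm (F R x - F (r n) x))\<^sup>2))"
      using conv
    proof eventually_elim
      case (elim x)
      then have "(\<lambda>n. F (r n) x) \<longlonglongrightarrow> g x" by (simp add: g_def convergent_LIMSEQ_iff)
      then have "(\<lambda>n. ennreal ((norm (F R x - F (r n) x))\<^sup>2)) \<longlonglongrightarrow> ennreal ((norm (F R x - g x))\<^sup>2)"
        by (intro tendsto_intros tendsto_ennrealI)
      then show ?case by (rule lim_imp_Liminf [OF sequentially_bot, symmetric])
    qed
    then have "(\<integral>\<^sup>+ x. ennreal ((norm (F R x - g x))\<^sup>2) \<partial>M)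
      = (\<integral>\<^sup>+ x. liminf (\<lambda>n. ennreal ((norm (F R x - F (r n) x))\<^sup>2)) \<partial>M)"
      by (rule nn_integral_cong_AE)
    also have "\<dots> \<le> liminf (\<lambda>n. \<integral>\<^sup>+ x. ennreal ((norm (F R x - F (r n) x))\<^sup>2) \<partial>M)"
      by (rule nn_integral_liminf) measurable
    also have "\<dots> \<le> a R"
    proof (rule Liminf_le)
      show "\<forall>\<^sub>F n in sequentially. (\<integral>\<^sup>+ x. ennreal ((norm (F R x - F (r n) x))\<^sup>2) \<partial>M) \<le> a R"
        using eventually_ge_at_top [of "nat \<lceil>R\<rceil>"]
      proof eventually_elim
        case (elim n)
        then have "R \<le> r n" using r(1) [of n] by linarith
        from le [OF this] show ?case by (subst sym)
      qed
    qed simp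
    finally show "(\<integral>\<^sup>+ x. ennreal ((norm (F R x - g x))\<^sup>2) \<partial>M) \<le> a R" .
  qed
qed

section \<open>Truncation and the Fourier transform of square-integrable functions\<close>

definition cutoff :: "real \<Rightarrow> (real \<Rightarrow> complex) \<Rightarrow> real \<Rightarrow> complex" where
  "cutoff R h x = indicator {-R..R} x *\<^sub>R h x"

definition tail :: "real \<Rightarrow> (real \<Rightarrow> complex) \<Rightarrow> ennreal" where
  "tail R h = (\<integral>\<^sup>+ x. ennreal ((norm (h x - cutoff R h x))\<^sup>2) \<partial>lborel)"

definition L2 :: "(real \<Rightarrow> complex) set" where
  "L2 = {h \<in> borel_measurable borel. (\<integral>\<^sup>+ x. ennreal ((norm (h x))\<^sup>2) \<partial>lborel) < \<infinity>}"

lemma borel_measurable_cutoff [measurable]: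
  "h \<in> borel_measurable borel \<Longrightarrow> cutoff R h \<in> borel_measurable borel"
  unfolding cutoff_def by measurable

lemma le_one_plus_power2: "y \<le> 1 + y\<^sup>2" for y :: real
proof -
  have "0 \<le> (y - 1 / 2)\<^sup>2" by simp
  then show ?thesis by (simp add: power2_eq_square algebra_simps)
qed

text \<open>On a bounded interval the norm of \<open>h\<close> is dominated by
  \<open>1 + (norm (h x))^2\<close>, so square integrability gives integrability there.\<close>

lemma integrable_cutoff:
  assumes "h \<in> L2"
  shows "integrable lborel (cutoff R h)"
proof (rule Bochner_Integration.integrable_bound)
  have [measurable]: "h \<in> borel_measurable borel" using assms by (simp add: L2_def)
  have "integrable lborel (\<lambda>x. (norm (h x))\<^sup>2)"
    using assms by (intro integrableI_bounded) (auto simp: L2_def)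
  then show "integrable lborel (\<lambda>x. indicator {-R..R} x + (norm (h x))\<^sup>2)"
    by (intro Bochner_Integration.integrable_add) (auto simp: emeasure_lborel_Icc_eq)
  show "AE x in lborel. norm (cutoff R h x) \<le> norm (indicator {-R..R} x + (norm (h x))\<^sup>2)"
    by (auto simp: cutoff_def indicator_def le_one_plus_power2)
  show "cutoff R h \<in> borel_measurable lborel" by measurable
qed

lemma tail_tendsto_0:
  assumes "h \<in> L2"
  shows "((\<lambda>R. tail R h) \<longlongrightarrow> 0) at_top"
proof (rule tendsto_at_topI_sequentially)
  fix X :: "nat \<Rightarrow> real" assume X: "filterlim X at_top sequentially"
  have [measurable]: "h \<in> borel_measurable borel" using assms by (simp add: L2_def)
  have "(\<lambda>n. tail (X n) h) \<longlonglongrightarrow> (\<integral>\<^sup>+ (x::real). 0 \<partial>lborel)"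
    unfolding tail_def
  proof (rule nn_integral_dominated_convergence [where w = "\<lambda>x. ennreal ((norm (h x))\<^sup>2)"])
    show "AE x in lborel. (\<lambda>n. ennreal ((norm (h x - cutoff (X n) h x))\<^sup>2)) \<longlonglongrightarrow> 0"
    proof (intro AE_I2 tendsto_eventually)
      fix x
      from X have "eventually (\<lambda>n. \<bar>x\<bar> \<le> X n) sequentially" by (simp add: filterlim_at_top)
      then show "eventually (\<lambda>n. ennreal ((norm (h x - cutoff (X n) h x))\<^sup>2) = 0) sequentially"
        by eventually_elim (auto simp: cutoff_def indicator_def)
    qed
  qed (use assms in \<open>auto simp: L2_def cutoff_def indicator_def\<close>)
  then show "(\<lambda>n. tail (X n) h) \<longlonglongrightarrow> 0" by simp
qed

text \<open>Plancherel's inequality makes the truncated transforms Cauchy, with a rate in terms of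
  \<open>tail R h\<close> that \<open>L2_complete\<close> passes on to the limit.\<close>

lemma fourier_cutoff_diff_le:
  assumes "h \<in> L2" "R \<le> S"
  shows "(\<integral>\<^sup>+ t. ennreal ((norm (fourier (cutoff S h) t - fourier (cutoff R h) t))\<^sup>2) \<partial>lborel)
     \<le> ennreal (2 * pi) * tail R h"
proof -
  have "(\<integral>\<^sup>+ t. ennreal ((norm (fourier (cutoff S h) t - fourier (cutoff R h) t))\<^sup>2) \<partial>lborel)
     \<le> ennreal (2 * pi) * (\<integral>\<^sup>+ x. ennreal ((norm (cutoff S h x - cutoff R h x))\<^sup>2) \<partial>lborel)"
    using plancherel_le [of "\<lambda>x. cutoff S h x - cutoff R h x"] integrable_cutoff [OF assms(1)]
    by (simp add: fourier_diff)
  also have "\<dots> \<le> ennreal (2 * pi) * tail R h"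
    unfolding tail_def using assms(2)
    by (intro mult_left_mono nn_integral_mono) (auto simp: cutoff_def indicator_def)
  finally show ?thesis .
qed

lemma L2_fourier_exists:
  assumes h: "h \<in> L2"
  obtains g where "g \<in> L2"
    "\<And>R. (\<integral>\<^sup>+ t. ennreal ((norm (fourier (cutoff R h) t - g t))\<^sup>2) \<partial>lborel) \<le> ennreal (2 * pi) * tail R h"
proof -
  have F [measurable]: "fourier (cutoff R h) \<in> borel_measurable borel" for R
    by (intro borel_measurable_fourier integrable_cutoff h)
  have "((\<lambda>R. ennreal (2 * pi) * tail R h) \<longlongrightarrow> ennreal (2 * pi) * 0) at_top"
    by (intro ennreal_tendsto_cmult tail_tendsto_0 h) auto
  then obtain g where g: "g \<in> borel_measurable lborel"
    "\<And>R. (\<integral>\<^sup>+ t. ennreal ((norm (fourier (cutoff R h) t - g t))\<^sup>2) \<partial>lborel) \<le> ennreal (2 * pi) * tail R h"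
    using L2_complete [of "\<lambda>R. fourier (cutoff R h)" lborel "\<lambda>R. ennreal (2 * pi) * tail R h"] fourier_cutoff_diff_le [OF h]
    by auto
  then have [measurable]: "g \<in> borel_measurable borel" by simp
  \<comment> \<open>At \<open>R = - 1\<close> the interval of the cutoff is empty, so the rate
    estimate for that \<open>R\<close> bounds the squared norm of \<open>g\<close> itself by
    \<open>2 * pi\<close> times that of \<open>h\<close>.\<close>
  have "fourier (cutoff (- 1) h) t = 0" for t by (simp add: fourier_def cutoff_def)
  moreover have "tail (- 1) h < \<infinity>" using h by (simp add: tail_def cutoff_def L2_def)
  ultimately have "(\<integral>\<^sup>+ t. ennreal ((norm (g t))\<^sup>2) \<partial>lborel) < \<infinity>"
    using g(2) [of "- 1"] by (simp add: ennreal_mult_less_top order.strict_trans1)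
  then show ?thesis using that [of g] g by (simp add: L2_def)
qed

text \<open>On \<open>S\<close> the function \<open>g\<close> equals
  \<open>g - fourier (f n)\<close>, whose norm is compared with the truncated transforms of
  \<open>h\<close>. Plancherel's inequality for \<open>f n - cutoff R h\<close> shows that all the
  errors can be made small, so \<open>g\<close> restricted to \<open>S\<close> has norm 0.\<close>

lemma fourier_vanishes:
  assumes h: "h \<in> L2" and g: "g \<in> L2" and S [measurable]: "S \<in> sets borel"
    and lim: "((\<lambda>R. \<integral>\<^sup>+ t. ennreal ((norm (fourier (cutoff R h) t - g t))\<^sup>2) \<partial>lborel) \<longlongrightarrow> 0) at_top"
    and f: "\<And>n. integrable lborel (f n)" "\<And>n t. t \<in> S \<Longrightarrow> fourier (f n) t = 0"
    and f_lim: "(\<lambda>n. \<integral>\<^sup>+ x. ennreal ((norm (f n x - h x))\<^sup>2) \<partial>lborel) \<longlonglongrightarrow> 0"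
  shows "AE t in lborel. t \<in> S \<longrightarrow> g t = 0"
proof -
  have [measurable]: "h \<in> borel_measurable borel" "g \<in> borel_measurable borel"
    "f n \<in> borel_measurable borel" "fourier (f n) \<in> borel_measurable borel"
    "fourier (cutoff R h) \<in> borel_measurable borel" for n R
    using h g borel_measurable_integrable [OF f(1)] borel_measurable_fourier [OF f(1)]
      borel_measurable_fourier [OF integrable_cutoff [OF h]] by (auto simp: L2_def)
  let ?A = "\<lambda>R. \<integral>\<^sup>+ t. ennreal ((norm (fourier (cutoff R h) t - g t))\<^sup>2) \<partial>lborel"
  let ?B = "\<lambda>n. \<integral>\<^sup>+ x. ennreal ((norm (f n x - h x))\<^sup>2) \<partial>lborel"
  let ?I = "\<integral>\<^sup>+ t. ennreal ((norm (indicator S t *\<^sub>R g t))\<^sup>2) \<partial>lborel"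
  let ?C = "\<lambda>R n. 2 * (ennreal (2 * pi) * (2 * tail R h + 2 * ?B n)) + 2 * ?A R"
  have bound: "?I \<le> ?C R n" for n R
  proof -
    have "?I \<le> (\<integral>\<^sup>+ t. ennreal ((norm (fourier (f n) t - g t))\<^sup>2) \<partial>lborel)"
      by (intro nn_integral_mono) (auto simp: indicator_def f(2))
    also have "\<dots> \<le> 2 * (\<integral>\<^sup>+ t. ennreal ((norm (fourier (f n) t - fourier (cutoff R h) t))\<^sup>2) \<partial>lborel) + 2 * ?A R"
      by (rule nn_integral_norm_diff_le) measurable
    also have "(\<integral>\<^sup>+ t. ennreal ((norm (fourier (f n) t - fourier (cutoff R h) t))\<^sup>2) \<partial>lborel)
        \<le> ennreal (2 * pi) * (\<integral>\<^sup>+ x. ennreal ((norm (f n x - cutoff R h x))\<^sup>2) \<partial>lborel)"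
      using plancherel_le [of "\<lambda>x. f n x - cutoff R h x"] integrable_cutoff [OF h] f(1)
      by (simp add: fourier_diff)
    also have "(\<integral>\<^sup>+ x. ennreal ((norm (f n x - cutoff R h x))\<^sup>2) \<partial>lborel) \<le> 2 * ?B n + 2 * tail R h"
      unfolding tail_def by (rule nn_integral_norm_diff_le) measurable
    finally show ?thesis by (simp add: add.commute add_left_mono mult_left_mono)
  qed
  have nat_top: "filterlim real at_top sequentially" by (rule filterlim_real_sequentially)
  \<comment> \<open>Putting \<open>R = n\<close> sends the truncation error and the approximation
    error to 0 along one sequence.\<close>
  have "(\<lambda>n. ?C (real n) n) \<longlonglongrightarrow> 2 * (ennreal (2 * pi) * (2 * 0 + 2 * 0)) + 2 * 0"
    by (intro tendsto_add ennreal_tendsto_cmult f_lim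
        filterlim_compose [OF tail_tendsto_0 [OF h] nat_top] filterlim_compose [OF lim nat_top])
      (auto simp: ennreal_mult_less_top)
  then have "?I \<le> 2 * (ennreal (2 * pi) * (2 * 0 + 2 * 0)) + 2 * 0"
    by (rule LIMSEQ_le_const) (use bound in blast)
  then have "?I = 0" by simp
  then have "AE t in lborel. ennreal ((norm (indicator S t *\<^sub>R g t))\<^sup>2) = 0"
    by (subst (asm) nn_integral_0_iff_AE) auto
  then show ?thesis by eventually_elim (auto simp: indicator_def split: if_splits)
qed

section \<open>Entire functions of exponential type have band-limited transforms\<close>

text \<open>The factor \<open>1 - i e z\<close> has its only zero at \<open>- i / e\<close>, below
  the real axis. In the closed upper half-plane the cross term \<open>2 e Im z\<close> of its
  squared modulus is nonnegative, and dropping it gives both bounds.\<close>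

lemma one_minus_imaginary_mult_ge:
  assumes "e > 0" "Im z \<ge> 0"
  shows "1 \<le> norm (1 - \<i> * complex_of_real e * z)"
    "1 + e\<^sup>2 * (norm z)\<^sup>2 \<le> (norm (1 - \<i> * complex_of_real e * z))\<^sup>2"
proof -
  have eq: "(norm (1 - \<i> * complex_of_real e * z))\<^sup>2 = (1 + e * Im z)\<^sup>2 + (e * Re z)\<^sup>2"
    by (simp add: cmod_power2)
  have "0 \<le> e * Im z" using assms by simp
  then show *: "1 + e\<^sup>2 * (norm z)\<^sup>2 \<le> (norm (1 - \<i> * complex_of_real e * z))\<^sup>2"
    unfolding eq cmod_power2 [of z] by (simp add: power2_eq_square algebra_simps)
  then have "1\<^sup>2 \<le> (norm (1 - \<i> * complex_of_real e * z))\<^sup>2"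
    by (smt (verit) one_power2 zero_le_mult_iff zero_le_power2)
  then show "1 \<le> norm (1 - \<i> * complex_of_real e * z)"
    by (rule power2_le_imp_le) simp
qed

lemma integrable_inverse_quadratic:
  assumes "e > 0"
  shows "integrable lborel (\<lambda>x. 1 / (1 + e\<^sup>2 * x\<^sup>2 :: real))"
proof -
  have "set_integrable lborel (einterval (-\<infinity>) \<infinity>) (\<lambda>x. 1 / (1 + x\<^sup>2))"
    using integrable_inverse_1_plus_square by (simp add: divide_inverse)
  then have "integrable lborel (\<lambda>x. 1 / (1 + x\<^sup>2 :: real))"
    by (simp add: set_integrable_def)
  from lborel_integrable_real_affine [OF this, of e 0] show ?thesis
    using assms by (simp add: power_mult_distrib)
qed

text \<open>The squared denominator makes the function integrable on the real line and keeps the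
  integral over the arc of radius \<open>R\<close> of order \<open>1 / R\<close>. For
  \<open>t >= T\<close> the growth of \<open>G\<close> is compensated by the exponential in the
  upper half-plane, and the pole lies outside it, so closing the contour there leaves 0.\<close>

lemma fourier_half_plane:
  assumes G: "G holomorphic_on UNIV" and bound: "\<And>z. norm (G z) \<le> C * exp (T * \<bar>Im z\<bar>)"
    and e: "e > 0" and t: "T \<le> t"
  defines "f \<equiv> \<lambda>x. G (complex_of_real x) / (1 - \<i> * complex_of_real e * complex_of_real x)\<^sup>2"
  shows "integrable lborel f" "fourier f t = 0"
proof -
  have "norm (G 0) \<le> C" using bound [of 0] by simp
  then have C: "C \<ge> 0" by (smt (verit) norm_ge_zero)
  have contG: "continuous_on UNIV G" using G by (rule holomorphic_on_imp_continuous_on)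
  have nz: "1 - \<i> * complex_of_real e * z \<noteq> 0" if "Im z > - (1 / e)" for z
  proof
    assume "1 - \<i> * complex_of_real e * z = 0"
    then have "Re (1 - \<i> * complex_of_real e * z) = 0" by simp
    then show False using that e by (simp add: field_simps)
  qed
  have nz_real: "1 - \<i> * complex_of_real e * complex_of_real x \<noteq> 0" for x
    using nz e by simp
  have contf: "continuous_on UNIV f"
    unfolding f_def
    by (intro continuous_intros continuous_on_compose2 [OF contG]) (use nz_real in auto)
  then have [measurable]: "f \<in> borel_measurable borel" by (rule borel_measurable_continuous_onI)
  have fle: "norm (f x) \<le> C * (1 / (1 + e\<^sup>2 * x\<^sup>2))" for x
  proof -
    have "norm (f x) \<le> C / (norm (1 - \<i> * complex_of_real e * complex_of_real x))\<^sup>2"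
      unfolding f_def norm_divide norm_power
      using bound [of "complex_of_real x"] by (intro divide_right_mono) auto
    also have "\<dots> \<le> C / (1 + e\<^sup>2 * x\<^sup>2)"
      using one_minus_imaginary_mult_ge(2) [OF e, of "complex_of_real x"] C
      by (intro frac_le) (auto simp: add_pos_nonneg)
    finally show ?thesis by simp
  qed
  show int: "integrable lborel f"
  proof (rule Bochner_Integration.integrable_bound)
    show "integrable lborel (\<lambda>x. C * (1 / (1 + e\<^sup>2 * x\<^sup>2)))"
      by (intro integrable_mult_right integrable_inverse_quadratic e)
    show "AE x in lborel. norm (f x) \<le> norm (C * (1 / (1 + e\<^sup>2 * x\<^sup>2)))"
      using fle C by simp
  qed measurable
  define q where "q z = G z * exp (\<i> * complex_of_real t * z) / (1 - \<i> * complex_of_real e * z)\<^sup>2" for z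
  define J where "J R = (LINT x|lborel. indicator {-R..R} x *\<^sub>R (f x * cis (t * x)))" for R
  have Jle: "norm (J R) \<le> C / (1 + e\<^sup>2 * R\<^sup>2) * R * pi" if R: "R > 0" for R
  proof -
    \<comment> \<open>This half-plane begins at the height of the pole \<open>- i / e\<close>. It is
      convex and contains the half-disc with its diameter, so Cauchy's theorem applies to the closed
      contour.\<close>
    let ?H = "{z. Im z > - (1 / e)}"
    have holq: "q holomorphic_on ?H"
      unfolding q_def using nz
      by (intro holomorphic_intros holomorphic_on_subset [OF G]) auto
    have conv: "convex ?H" using convex_halfspace_Im_gt by simp
    let ?p = "part_circlepath 0 R 0 pi"
    let ?l = "linepath (complex_of_real (-R)) (complex_of_real R)"
    have e': "- (1 / e) < 0" using e by simp
    have im_p: "Im z \<ge> 0 \<and> norm z = R" if "z \<in> path_image ?p" for z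
      using that R by (auto simp: path_image_part_circlepath norm_mult cis_conv_exp [symmetric] sin_ge_zero
          intro!: mult_nonneg_nonneg)
    have p_sub: "path_image ?p \<subseteq> ?H" using order.strict_trans2 [OF e'] im_p by blast
    have l_sub: "path_image ?l \<subseteq> ?H"
      using e' conv by (simp del: of_real_minus) (intro closed_segment_subset, auto)
    have "(q has_contour_integral 0) (?l +++ ?p)"
      using R p_sub l_sub
      by (intro Cauchy_theorem_convex_simple [OF holq conv] valid_path_join) 
        (auto simp: path_image_join simp del: of_real_minus)
    moreover have cq: "q contour_integrable_on ?l" "q contour_integrable_on ?p"
      using p_sub l_sub holq
      by (auto intro!: contour_integrable_continuous_linepath contour_integrable_continuous_part_circlepath
          continuous_on_subset [OF holomorphic_on_imp_continuous_on])
    ultimately have sum0: "contour_integral ?l q + contour_integral ?p q = 0"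
      by (metis contour_integral_join contour_integral_unique valid_path_linepath valid_path_part_circlepath)
    have "norm (contour_integral ?p q) \<le> C / (1 + e\<^sup>2 * R\<^sup>2) * R * \<bar>pi - 0\<bar>"
    proof (rule contour_integral_bound_part_circlepath [OF cq(2)])
      fix z assume "z \<in> path_image ?p"
      then have z: "Im z \<ge> 0" "norm z = R" using im_p by auto
      \<comment> \<open>The exponential contributes \<open>exp (- t * Im z)\<close>, which offsets
        the growth \<open>exp (T * Im z)\<close> because \<open>T <= t\<close> and
        \<open>Im z >= 0\<close>.\<close>
      have "norm (G z * exp (\<i> * complex_of_real t * z)) \<le> C * exp (T * Im z) * exp (- (t * Im z))"
        using bound [of z] z by (simp add: norm_mult)
      also have "\<dots> = C * exp ((T - t) * Im z)" by (simp add: left_diff_distrib exp_diff exp_minus divide_inverse)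
      also have "\<dots> \<le> C * 1" using z t C by (intro mult_left_mono) (auto simp: mult_nonpos_nonneg)
      finally have num: "norm (G z * exp (\<i> * complex_of_real t * z)) \<le> C" by simp
      have den: "1 + e\<^sup>2 * R\<^sup>2 \<le> (norm (1 - \<i> * complex_of_real e * z))\<^sup>2"
        using one_minus_imaginary_mult_ge(2) [OF e z(1)] z(2) by simp
      show "norm (q z) \<le> C / (1 + e\<^sup>2 * R\<^sup>2)"
        unfolding q_def norm_divide norm_power
        by (intro frac_le C num den) (simp add: add_pos_nonneg)
    qed (use R C in auto)
    moreover have "contour_integral ?l q = J R"
    proof -
      have "contour_integral ?l q = integral {-R..R} (\<lambda>x. q (complex_of_real x))"
        using R by (subst contour_integral_linepath_Reals_eq) auto
      also have "\<dots> = integral {-R..R} (\<lambda>x. f x * cis (t * x))"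
        by (simp add: q_def f_def cis_conv_exp mult_ac)
      also have "\<dots> = (LINT x:{-R..R}|lborel. f x * cis (t * x))"
        using integrable_mult_cis [OF int, of "\<lambda>x. t * x"]
        by (intro set_borel_integral_eq_integral(2) [symmetric])
          (auto simp: set_integrable_def intro: integrable_mult_indicator)
      finally show ?thesis by (simp add: J_def set_lebesgue_integral_def)
    qed
    ultimately show ?thesis using sum0 by (simp add: add_eq_0_iff norm_minus_cancel)
  qed
  have "(\<lambda>n. J (real (Suc n))) \<longlonglongrightarrow> fourier f t"
    unfolding J_def fourier_def
  proof (rule integral_dominated_convergence [where w = "\<lambda>x. norm (f x)"])
    show "AE x in lborel. (\<lambda>n. indicator {- real (Suc n)..real (Suc n)} x *\<^sub>R (f x * cis (t * x))) \<longlonglongrightarrow> f x * cis (t * x)"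
    proof (intro AE_I2 tendsto_eventually)
      fix x :: real
      show "eventually (\<lambda>n. indicator {- real (Suc n)..real (Suc n)} x *\<^sub>R (f x * cis (t * x)) = f x * cis (t * x)) sequentially"
        using eventually_ge_at_top [of "nat \<lceil>\<bar>x\<bar>\<rceil>"]
      proof eventually_elim
        case (elim n)
        then have "\<bar>x\<bar> \<le> real (Suc n)" by linarith
        then show ?case by (auto simp: indicator_def abs_le_iff)
      qed
    qed
  qed (use int in \<open>auto simp: norm_mult indicator_def\<close>)
  moreover have "(\<lambda>n. J (real (Suc n))) \<longlonglongrightarrow> 0"
  proof (rule Lim_null_comparison)
    show "\<forall>\<^sub>F n in sequentially. norm (J (real (Suc n))) \<le> C / (1 + e\<^sup>2 * (real (Suc n))\<^sup>2) * real (Suc n) * pi"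
      using Jle by (intro always_eventually) auto
    show "(\<lambda>n. C / (1 + e\<^sup>2 * (real (Suc n))\<^sup>2) * real (Suc n) * pi) \<longlonglongrightarrow> 0"
      using e by real_asymp
  qed
  ultimately show "fourier f t = 0" by (rule LIMSEQ_unique)
qed

text \<open>For real \<open>x\<close> the denominator has modulus at least 1 whatever the sign of
  \<open>\<sigma> n\<close>, so four times the squared norm of \<open>h\<close> dominates. Negative
  values serve the reflected case.\<close>

lemma L2_resolvent_tendsto:
  assumes h: "h \<in> L2" and \<sigma>: "\<sigma> \<longlonglongrightarrow> 0"
  shows "(\<lambda>n. \<integral>\<^sup>+ x. ennreal ((norm (h x / (1 - \<i> * complex_of_real (\<sigma> n) * complex_of_real x)\<^sup>2 - h x))\<^sup>2) \<partial>lborel)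
     \<longlonglongrightarrow> 0"
proof -
  have [measurable]: "h \<in> borel_measurable borel" using h by (simp add: L2_def)
  let ?f = "\<lambda>n x. h x / (1 - \<i> * complex_of_real (\<sigma> n) * complex_of_real x)\<^sup>2"
  have "(\<lambda>n. \<integral>\<^sup>+ x. ennreal ((norm (?f n x - h x))\<^sup>2) \<partial>lborel) \<longlonglongrightarrow> (\<integral>\<^sup>+ (x::real). 0 \<partial>lborel)"
  proof (rule nn_integral_dominated_convergence [where w = "\<lambda>x. 4 * ennreal ((norm (h x))\<^sup>2)"])
    show "AE x in lborel. ennreal ((norm (?f n x - h x))\<^sup>2) \<le> 4 * ennreal ((norm (h x))\<^sup>2)" for n
    proof (intro AE_I2)
      fix x
      have "1\<^sup>2 \<le> (norm (1 - \<i> * complex_of_real (\<sigma> n) * complex_of_real x))\<^sup>2"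
        by (simp add: cmod_power2)
      then have "norm (?f n x) \<le> norm (h x) / 1"
        unfolding norm_divide norm_power by (intro divide_left_mono) auto
      then have "norm (?f n x - h x) \<le> 2 * norm (h x)"
        using norm_triangle_ineq4 [of "?f n x" "h x"] by linarith
      then have "(norm (?f n x - h x))\<^sup>2 \<le> (2 * norm (h x))\<^sup>2"
        by (rule power_mono) simp
      then have "ennreal ((norm (?f n x - h x))\<^sup>2) \<le> ennreal (4 * (norm (h x))\<^sup>2)"
        by (intro ennreal_leI) (simp add: power_mult_distrib)
      then show "ennreal ((norm (?f n x - h x))\<^sup>2) \<le> 4 * ennreal ((norm (h x))\<^sup>2)"
        by (simp add: ennreal_mult')
    qed
    show "AE x in lborel. (\<lambda>n. ennreal ((norm (?f n x - h x))\<^sup>2)) \<longlonglongrightarrow> 0"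
    proof (intro AE_I2)
      fix x
      have "(\<lambda>n. ennreal ((norm (?f n x - h x))\<^sup>2)) \<longlonglongrightarrow>
          ennreal ((norm (h x / (1 - \<i> * complex_of_real 0 * complex_of_real x)\<^sup>2 - h x))\<^sup>2)"
        by (intro tendsto_ennrealI tendsto_intros \<sigma>) simp
      then show "(\<lambda>n. ennreal ((norm (?f n x - h x))\<^sup>2)) \<longlonglongrightarrow> 0" by simp
    qed
    show "(\<integral>\<^sup>+ x. 4 * ennreal ((norm (h x))\<^sup>2) \<partial>lborel) < \<infinity>"
      using h by (simp add: L2_def nn_integral_cmult ennreal_mult_less_top)
  qed measurable
  then show ?thesis by simp
qed

lemma fourier_reflect: "fourier (\<lambda>x. f (- x)) t = fourier f (- t)"
  unfolding fourier_def
  using lborel_integral_real_affine [of "- 1" "\<lambda>x. f x * cis (- t * x)" 0] by simp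

lemma fourier_transform_supported:
  assumes G: "G holomorphic_on UNIV" and bound: "\<And>z. norm (G z) \<le> C * exp (T * \<bar>Im z\<bar>)"
    and h: "(\<lambda>x. G (complex_of_real x)) \<in> L2" and g: "g \<in> L2"
    and lim: "((\<lambda>R. \<integral>\<^sup>+ t. ennreal ((norm (fourier (cutoff R (\<lambda>x. G (complex_of_real x))) t - g t))\<^sup>2) \<partial>lborel)
        \<longlongrightarrow> 0) at_top"
  shows "AE t in lborel. \<bar>t\<bar> > T \<longrightarrow> g t = 0"
proof -
  define s where "s n = inverse (real (Suc n))" for n
  have s: "s n > 0" for n by (simp add: s_def)
  have s0: "s \<longlonglongrightarrow> 0" unfolding s_def by (rule LIMSEQ_inverse_real_of_nat)
  then have s0': "(\<lambda>n. - s n) \<longlonglongrightarrow> 0" using tendsto_minus by fastforce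
  let ?h = "\<lambda>x. G (complex_of_real x)"
  have "AE t in lborel. t \<in> {T<..} \<longrightarrow> g t = 0"
  proof (rule fourier_vanishes [OF h g _ lim _ _ L2_resolvent_tendsto [OF h s0]])
    fix n t
    show "integrable lborel (\<lambda>x. ?h x / (1 - \<i> * complex_of_real (s n) * complex_of_real x)\<^sup>2)"
      by (rule fourier_half_plane(1) [OF G bound s order_refl])
    show "fourier (\<lambda>x. ?h x / (1 - \<i> * complex_of_real (s n) * complex_of_real x)\<^sup>2) t = 0" if "t \<in> {T<..}"
      using that by (intro fourier_half_plane(2) [OF G bound s]) auto
  qed simp
  moreover have "AE t in lborel. t \<in> {..<-T} \<longrightarrow> g t = 0"
  proof (rule fourier_vanishes [OF h g _ lim _ _ L2_resolvent_tendsto [OF h s0']])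
    \<comment> \<open>For \<open>t < - T\<close> the half-plane lemma is applied to
      \<open>G (- z)\<close> at the point \<open>- t\<close>. Undoing the reflection replaces
      \<open>s n\<close> by \<open>- s n\<close> in the regularising factor.\<close>
    have G': "(\<lambda>z. G (- z)) holomorphic_on UNIV"
      by (intro holomorphic_on_compose_gen [OF _ G, unfolded o_def] holomorphic_intros) auto
    have bound': "norm (G (- z)) \<le> C * exp (T * \<bar>Im z\<bar>)" for z using bound [of "- z"] by simp
    fix n t
    let ?f = "\<lambda>x. G (- complex_of_real x) / (1 - \<i> * complex_of_real (s n) * complex_of_real x)\<^sup>2"
    have eq: "(\<lambda>x. ?h x / (1 - \<i> * complex_of_real (- s n) * complex_of_real x)\<^sup>2) = (\<lambda>x. ?f (- x))"
      by simp
    have "integrable lborel ?f"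
      by (rule fourier_half_plane(1) [OF G' bound' s order_refl])
    from lborel_integrable_real_affine [OF this, of "- 1" 0]
    show "integrable lborel (\<lambda>x. ?h x / (1 - \<i> * complex_of_real (- s n) * complex_of_real x)\<^sup>2)"
      unfolding eq by simp
    show "fourier (\<lambda>x. ?h x / (1 - \<i> * complex_of_real (- s n) * complex_of_real x)\<^sup>2) t = 0" if "t \<in> {..<-T}"
      unfolding eq fourier_reflect [of ?f] using that by (intro fourier_half_plane(2) [OF G' bound' s]) auto
  qed simp
  ultimately show ?thesis by eventually_elim (auto simp: abs_if split: if_splits)
qed

theorem paley_wiener_transform:
  assumes G: "G holomorphic_on UNIV" and bound: "\<And>z. norm (G z) \<le> C * exp (T * \<bar>Im z\<bar>)"
    and h: "(\<lambda>x. G (complex_of_real x)) \<in> L2"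
  obtains g where "g \<in> L2" "AE t in lborel. \<bar>t\<bar> > T \<longrightarrow> g t = 0"
    "((\<lambda>R. \<integral>\<^sup>+ t. ennreal ((norm (fourier (cutoff R (\<lambda>x. G (complex_of_real x))) t - g t))\<^sup>2) \<partial>lborel)
        \<longlongrightarrow> 0) at_top"
proof -
  obtain g where g: "g \<in> L2" "\<And>R. (\<integral>\<^sup>+ t. ennreal ((norm (fourier (cutoff R (\<lambda>x. G (complex_of_real x))) t - g t))\<^sup>2) \<partial>lborel)
      \<le> ennreal (2 * pi) * tail R (\<lambda>x. G (complex_of_real x))"
    by (rule L2_fourier_exists [OF h]) (rule that)
  have "((\<lambda>R. ennreal (2 * pi) * tail R (\<lambda>x. G (complex_of_real x))) \<longlongrightarrow> ennreal (2 * pi) * 0) at_top"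
    by (intro ennreal_tendsto_cmult tail_tendsto_0 h) auto
  then have 0: "((\<lambda>R. ennreal (2 * pi) * tail R (\<lambda>x. G (complex_of_real x))) \<longlongrightarrow> 0) at_top" by simp
  have lim: "((\<lambda>R. \<integral>\<^sup>+ t. ennreal ((norm (fourier (cutoff R (\<lambda>x. G (complex_of_real x))) t - g t))\<^sup>2) \<partial>lborel)
        \<longlongrightarrow> 0) at_top"
    by (rule tendsto_sandwich [OF _ _ tendsto_const 0]) (auto intro!: always_eventually g(2))
  show ?thesis
    using that [OF g(1) fourier_transform_supported [OF G bound h g(1) lim] lim] .
qed

section \<open>Inversion and entire extension\<close>

text \<open>With \<open>v = d^2 / (2 s^2)\<close> the second-order Taylor bound gives
  \<open>exp (- v) <= 2 / v^2 = 8 s^4 / d^4\<close>, and the prefactor is at most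
  \<open>1 / s\<close>. The power \<open>s ^ 3\<close> matters: it still tends to 0 after a division
  by \<open>s\<close>.\<close>

lemma normal_density_le:
  assumes s: "s > 0" and d: "d > 0" "d \<le> \<bar>y - x\<bar>"
  shows "normal_density x s y \<le> 8 * s ^ 3 / d ^ 4"
proof -
  define v where "v = d\<^sup>2 / (2 * s\<^sup>2)"
  have v: "v > 0" using s d by (simp add: v_def)
  have "v\<^sup>2 / 2 \<le> exp v" using exp_lower_Taylor_quadratic [of v] v by simp
  then have *: "exp (- v) \<le> 2 / v\<^sup>2" using v by (simp add: exp_minus field_simps)
  have "d\<^sup>2 \<le> (y - x)\<^sup>2" using d power_mono [of d "\<bar>y - x\<bar>" 2] by simp
  then have "- (y - x)\<^sup>2 / (2 * s\<^sup>2) \<le> - v"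
    unfolding v_def using s by (simp add: divide_right_mono)
  then have "exp (- (y - x)\<^sup>2 / (2 * s\<^sup>2)) \<le> 2 / v\<^sup>2" using * by (meson exp_le_cancel_iff order_trans)
  moreover have "1 / sqrt (2 * pi * s\<^sup>2) \<le> 1 / s"
  proof -
    have "1 * s \<le> sqrt (2 * pi) * s" using s pi_ge_two by (intro mult_right_mono) auto
    then show ?thesis using s by (intro divide_left_mono) (auto simp: real_sqrt_mult)
  qed
  ultimately have "normal_density x s y \<le> 1 / s * (2 / v\<^sup>2)"
    unfolding normal_density_def using s by (intro mult_mono) auto
  also have "\<dots> = 8 * s ^ 3 / d ^ 4"
    using s d by (simp add: v_def field_simps power2_eq_square power3_eq_cube power4_eq_xxxx)
  finally show ?thesis .
qed

text \<open>The density is both bounded and integrable: its peak value controls the term with the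
  squared norm of \<open>h\<close>, and its integral controls the constant in
  \<open>norm (h y) <= (norm (h y))^2 + 1\<close>.\<close>

lemma integrable_L2_normal_density:
  fixes h :: "real \<Rightarrow> complex"
  assumes h: "h \<in> L2" and s: "s > 0"
  shows "integrable lborel (\<lambda>y. h y * complex_of_real (normal_density x s y))"
proof (rule Bochner_Integration.integrable_bound)
  have [measurable]: "h \<in> borel_measurable borel" using h by (simp add: L2_def)
  have "integrable lborel (\<lambda>y. (norm (h y))\<^sup>2)"
    using h by (intro integrableI_bounded) (auto simp: L2_def)
  then show "integrable lborel (\<lambda>y. (norm (h y))\<^sup>2 * (1 / sqrt (2 * pi * s\<^sup>2)) + normal_density x s y)"
    using s by (intro Bochner_Integration.integrable_add integrable_mult_left) auto
  show "AE y in lborel. norm (h y * complex_of_real (normal_density x s y))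
      \<le> norm ((norm (h y))\<^sup>2 * (1 / sqrt (2 * pi * s\<^sup>2)) + normal_density x s y)"
  proof (intro AE_I2)
    fix y
    have "norm (h y) \<le> (norm (h y))\<^sup>2 + 1" using le_one_plus_power2 [of "norm (h y)"] by simp
    then have "norm (h y) * normal_density x s y \<le> ((norm (h y))\<^sup>2 + 1) * normal_density x s y"
      by (rule mult_right_mono) simp
    also have "\<dots> \<le> (norm (h y))\<^sup>2 * (1 / sqrt (2 * pi * s\<^sup>2)) + normal_density x s y"
      unfolding distrib_right
      by (intro add_mono mult_left_mono) (auto simp: normal_density_def divide_right_mono)
    finally show "norm (h y * complex_of_real (normal_density x s y))
      \<le> norm ((norm (h y))\<^sup>2 * (1 / sqrt (2 * pi * s\<^sup>2)) + normal_density x s y)"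
      by (simp add: norm_mult)
  qed
  show "(\<lambda>y. h y * complex_of_real (normal_density x s y)) \<in> borel_measurable lborel" by measurable
qed

text \<open>Near \<open>x\<close> continuity suffices. Far from \<open>x\<close> the function is
  only square-integrable, so \<open>norm (h y) * N\<close> is split as
  \<open>r * (norm (h y))^2 + N^2 / r\<close>, where the decay of the density \<open>N\<close>
  absorbs the division by \<open>r\<close>. The constant \<open>h x\<close> is handled by
  Chebyshev's inequality.\<close>

lemma normal_density_approximate_identity:
  fixes h :: "real \<Rightarrow> complex"
  assumes h: "h \<in> L2" and cont: "isCont h x"
    and s: "s \<longlonglongrightarrow> 0" "\<And>n. s n > 0"
  shows "(\<lambda>n. LINT y|lborel. h y * complex_of_real (normal_density x (s n) y)) \<longlonglongrightarrow> h x"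
proof (rule metric_LIMSEQ_I)
  fix e :: real assume "e > 0"
  have [measurable]: "h \<in> borel_measurable borel" using h by (simp add: L2_def)
  have int: "integrable lborel (\<lambda>y. (norm (h y))\<^sup>2)"
    using h by (intro integrableI_bounded) (auto simp: L2_def)
  define I where "I = (LINT y|lborel. (norm (h y))\<^sup>2)"
  obtain d where d: "d > 0" "\<And>y. \<bar>y - x\<bar> < d \<Longrightarrow> norm (h y - h x) < e / 2"
    using cont \<open>e > 0\<close> unfolding continuous_at_eps_delta dist_norm real_norm_def by (metis half_gt_zero)
  \<comment> \<open>The summands come, in order, from the neighbourhood of \<open>x\<close>, from
    the square-integrable mass of \<open>h\<close>, from the decay of the density, and from its
    second moment. All but the first vanish as \<open>r\<close> tends to 0.\<close>
  define B where "B r = e / 2 + r * I + 8 * r\<^sup>2 / d ^ 4 + norm (h x) / d\<^sup>2 * r\<^sup>2" for r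
  have bound: "norm ((LINT y|lborel. h y * complex_of_real (normal_density x r y)) - h x) \<le> B r" if r: "r > 0" for r
  proof -
    let ?N = "normal_density x r"
    have mom: "has_bochner_integral lborel (\<lambda>y. ?N y * (y - x)\<^sup>2) (r\<^sup>2)"
      using normal_moment_even [OF r, of x 1] by simp
    have N1: "has_bochner_integral lborel ?N 1"
      using r by (simp add: has_bochner_integral_iff)
    have hbi: "has_bochner_integral lborel (\<lambda>y. e / 2 * ?N y + r * (norm (h y))\<^sup>2
          + 8 * r\<^sup>2 / d ^ 4 * ?N y + norm (h x) / d\<^sup>2 * (?N y * (y - x)\<^sup>2))
        (e / 2 * 1 + r * I + 8 * r\<^sup>2 / d ^ 4 * 1 + norm (h x) / d\<^sup>2 * r\<^sup>2)"
      unfolding I_def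
      by (intro has_bochner_integral_add has_bochner_integral_mult_right N1 mom has_bochner_integral_integrable int)
    have intN: "integrable lborel (\<lambda>y. h x * complex_of_real (?N y))"
      using r by (intro integrable_mult_right) auto
    have hx: "(LINT y|lborel. h x * complex_of_real (?N y)) = h x"
      using r by simp
    have "norm ((LINT y|lborel. h y * complex_of_real (?N y)) - h x)
        = norm (LINT y|lborel. h y * complex_of_real (?N y) - h x * complex_of_real (?N y))"
      by (simp only: Bochner_Integration.integral_diff [OF integrable_L2_normal_density [OF h r] intN] hx)
    also have "\<dots> \<le> (LINT y|lborel. e / 2 * ?N y + r * (norm (h y))\<^sup>2
        + 8 * r\<^sup>2 / d ^ 4 * ?N y + norm (h x) / d\<^sup>2 * (?N y * (y - x)\<^sup>2))"
    proof (rule Bochner_Integration.integral_norm_bound_integral)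
      show "integrable lborel (\<lambda>y. h y * complex_of_real (?N y) - h x * complex_of_real (?N y))"
        by (intro Bochner_Integration.integrable_diff integrable_L2_normal_density h r intN)
      show "integrable lborel (\<lambda>y. e / 2 * ?N y + r * (norm (h y))\<^sup>2
          + 8 * r\<^sup>2 / d ^ 4 * ?N y + norm (h x) / d\<^sup>2 * (?N y * (y - x)\<^sup>2))"
        using hbi by (rule integrable.intros)
      fix y
      have N0: "0 \<le> ?N y" by simp
      have eq: "norm (h y * complex_of_real (?N y) - h x * complex_of_real (?N y)) = norm (h y - h x) * ?N y"
        by (simp add: norm_mult flip: left_diff_distrib)
      show "norm (h y * complex_of_real (?N y) - h x * complex_of_real (?N y))
          \<le> e / 2 * ?N y + r * (norm (h y))\<^sup>2 + 8 * r\<^sup>2 / d ^ 4 * ?N y + norm (h x) / d\<^sup>2 * (?N y * (y - x)\<^sup>2)"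
      proof (cases "\<bar>y - x\<bar> < d")
        case True
        then have "norm (h y - h x) * ?N y \<le> e / 2 * ?N y"
          using d(2) by (intro mult_right_mono) (auto intro: less_imp_le)
        moreover have "0 \<le> r * (norm (h y))\<^sup>2" "0 \<le> 8 * r\<^sup>2 / d ^ 4 * ?N y"
          "0 \<le> norm (h x) / d\<^sup>2 * (?N y * (y - x)\<^sup>2)"
          using r d by auto
        ultimately show ?thesis unfolding eq by linarith
      next
        case False
        then have far: "d \<le> \<bar>y - x\<bar>" by simp
        have "norm (h y) * ?N y \<le> r * (norm (h y))\<^sup>2 + ?N y / r * ?N y"
        proof -
          \<comment> \<open>Completing the square gives
            \<open>r |h| N <= r^2 |h|^2 + N^2 / 4\<close>; the factor \<open>1/4\<close> is then
            weakened to 1 and \<open>r\<close> cancelled.\<close>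
          have "0 \<le> (r * norm (h y) - ?N y / 2)\<^sup>2" by simp
          then have "r * (norm (h y) * ?N y) \<le> r * (r * (norm (h y))\<^sup>2) + ?N y * ?N y / 4"
            by (simp add: power2_eq_square algebra_simps)
          also have "\<dots> \<le> r * (r * (norm (h y))\<^sup>2 + ?N y / r * ?N y)"
            using r by (simp add: distrib_left)
          finally show ?thesis using r by (simp only: mult_le_cancel_left_pos)
        qed
        also have "?N y / r * ?N y \<le> 8 * r\<^sup>2 / d ^ 4 * ?N y"
        proof (intro mult_right_mono N0)
          have "?N y / r \<le> 8 * r ^ 3 / d ^ 4 / r"
            using normal_density_le [OF r d(1) far] r by (intro divide_right_mono) auto
          also have "\<dots> = 8 * r\<^sup>2 / d ^ 4" using r by (simp add: power2_eq_square power3_eq_cube)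
          finally show "?N y / r \<le> 8 * r\<^sup>2 / d ^ 4" .
        qed
        finally have 1: "norm (h y) * ?N y \<le> r * (norm (h y))\<^sup>2 + 8 * r\<^sup>2 / d ^ 4 * ?N y" by simp
        \<comment> \<open>Chebyshev's trick: away from \<open>x\<close> the factor
          \<open>(y - x)^2 / d^2\<close> is at least 1, so inserting it turns the far mass into a
          second moment.\<close>
        have "d\<^sup>2 \<le> (y - x)\<^sup>2" using d(1) far power_mono [of d "\<bar>y - x\<bar>" 2] by simp
        then have "1 \<le> (y - x)\<^sup>2 / d\<^sup>2" using d(1) by simp
        then have "norm (h x) * ?N y * 1 \<le> norm (h x) * ?N y * ((y - x)\<^sup>2 / d\<^sup>2)"
          by (intro mult_left_mono) auto
        then have 2: "norm (h x) * ?N y \<le> norm (h x) / d\<^sup>2 * (?N y * (y - x)\<^sup>2)" by (simp add: mult_ac)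
        have "norm (h y - h x) * ?N y \<le> (norm (h y) + norm (h x)) * ?N y"
          by (intro mult_right_mono norm_triangle_ineq4 N0)
        also have "\<dots> \<le> r * (norm (h y))\<^sup>2 + 8 * r\<^sup>2 / d ^ 4 * ?N y + norm (h x) / d\<^sup>2 * (?N y * (y - x)\<^sup>2)"
          using 1 2 by (simp add: distrib_right)
        moreover have "0 \<le> e / 2 * ?N y" using \<open>e > 0\<close> by simp
        ultimately show ?thesis unfolding eq by linarith
      qed
    qed
    also have "\<dots> = B r"
      by (simp only: has_bochner_integral_integral_eq [OF hbi] B_def mult_1_right)
    finally show ?thesis .
  qed
  have "(\<lambda>n. B (s n)) \<longlonglongrightarrow> e / 2 + 0 * I + 8 * 0\<^sup>2 / d ^ 4 + norm (h x) / d\<^sup>2 * 0\<^sup>2"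
    unfolding B_def by (intro tendsto_intros s) (use d in auto)
  then have "eventually (\<lambda>n. B (s n) < e) sequentially"
    by (rule order_tendstoD) (use \<open>e > 0\<close> in auto)
  then obtain n0 where "\<And>n. n \<ge> n0 \<Longrightarrow> B (s n) < e" by (auto simp: eventually_sequentially)
  then show "\<exists>n0. \<forall>n\<ge>n0. dist (LINT y|lborel. h y * complex_of_real (normal_density x (s n) y)) (h x) < e"
    using bound [OF s(2)] by (auto simp: dist_norm intro: order.strict_trans1)
qed

text \<open>By Cauchy-Schwarz the squared integral is at most the product of the two squared norms.
  This carries convergence of transforms in \<open>L2\<close> through an integral against a fixed
  Gaussian weight.\<close>

lemma integral_product_tendsto_0:
  fixes f :: "nat \<Rightarrow> 'a \<Rightarrow> complex"
  assumes [measurable]: "\<And>n. f n \<in> borel_measurable M" "w \<in> borel_measurable M"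
    and f: "(\<lambda>n. \<integral>\<^sup>+ x. ennreal ((norm (f n x))\<^sup>2) \<partial>M) \<longlonglongrightarrow> 0"
    and w: "(\<integral>\<^sup>+ x. ennreal ((norm (w x))\<^sup>2) \<partial>M) < \<infinity>"
  shows "(\<lambda>n. integral\<^sup>L M (\<lambda>x. f n x * w x)) \<longlonglongrightarrow> 0"
proof -
  let ?W = "\<integral>\<^sup>+ x. ennreal ((norm (w x))\<^sup>2) \<partial>M"
  let ?F = "\<lambda>n. \<integral>\<^sup>+ x. ennreal ((norm (f n x))\<^sup>2) \<partial>M"
  let ?J = "\<lambda>n. integral\<^sup>L M (\<lambda>x. f n x * w x)"
  have le: "ennreal ((norm (?J n))\<^sup>2) \<le> ?F n * ?W" for n
  proof -
    have "ennreal (norm (?J n)) \<le> (\<integral>\<^sup>+ x. ennreal (norm (f n x)) * ennreal (norm (w x)) \<partial>M)"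
      using norm_integral_le_nn_integral [of M "\<lambda>x. f n x * w x"] by (simp add: norm_mult ennreal_mult)
    then have "(ennreal (norm (?J n)))\<^sup>2 \<le> (\<integral>\<^sup>+ x. ennreal (norm (f n x)) * ennreal (norm (w x)) \<partial>M)\<^sup>2"
      by (rule power_mono) simp
    also have "\<dots> \<le> (\<integral>\<^sup>+ x. (ennreal (norm (f n x)))\<^sup>2 \<partial>M) * (\<integral>\<^sup>+ x. (ennreal (norm (w x)))\<^sup>2 \<partial>M)"
      by (rule Cauchy_Schwarz_nn_integral) measurable
    finally show ?thesis by (simp add: ennreal_power)
  qed
  have "(\<lambda>n. ?W * ?F n) \<longlonglongrightarrow> ?W * 0"
    by (intro ennreal_tendsto_cmult f w[unfolded infinity_ennreal_def])
  then have 0: "(\<lambda>n. ?F n * ?W) \<longlonglongrightarrow> 0" by (simp add: mult.commute)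
  have "(\<lambda>n. ennreal ((norm (?J n))\<^sup>2)) \<longlonglongrightarrow> ennreal 0"
    using le by (intro tendsto_sandwich [OF _ _ tendsto_const 0, THEN tendsto_eq_rhs]) (auto intro!: always_eventually)
  then have "(\<lambda>n. (norm (?J n))\<^sup>2) \<longlonglongrightarrow> 0"
    by (subst (asm) tendsto_ennreal_iff) auto
  then have "(\<lambda>n. sqrt ((norm (?J n))\<^sup>2)) \<longlonglongrightarrow> sqrt 0" by (rule tendsto_real_sqrt)
  then show ?thesis by (simp add: tendsto_norm_zero_iff)
qed

text \<open>Two limits are taken in turn. For a fixed Gaussian weight the inversion formula passes
  from the cutoffs to \<open>h\<close>; then the width \<open>s\<close> tends to 0, where
  integrability of \<open>g\<close> handles the transform side and the approximate identity recovers
  \<open>h x\<close>.\<close>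

theorem fourier_inversion_L2:
  fixes g h :: "real \<Rightarrow> complex"
  assumes h: "h \<in> L2" and cont: "isCont h x"
    and g [measurable]: "g \<in> borel_measurable lebesgue" and gint: "integrable lebesgue g"
    and lim: "((\<lambda>R. \<integral>\<^sup>+ t. ennreal ((norm (fourier (cutoff R h) t - g t))\<^sup>2) \<partial>lebesgue) \<longlongrightarrow> 0) at_top"
  shows "(LINT t|lebesgue. g t * cis (- (t * x))) = 2 * pi * h x"
proof -
  have [measurable]: "h \<in> borel_measurable borel" using h by (simp add: L2_def)
  define F where "F n = fourier (cutoff (real n) h)" for n
  have F [measurable]: "F n \<in> borel_measurable borel" for n
    unfolding F_def by (intro borel_measurable_fourier integrable_cutoff h)
  have F' [measurable]: "F n \<in> borel_measurable lebesgue" for n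
    using F by (intro measurable_completion) simp
  have gauss: "(LINT t|lebesgue. g t * (cis (- (t * x)) * complex_of_real (exp (- (s * t)\<^sup>2 / 2))))
      = 2 * pi * (LINT y|lborel. h y * complex_of_real (normal_density x s y))" if s: "s > 0" for s
  proof -
    define w where "w t = cis (- (t * x)) * complex_of_real (exp (- (s * t)\<^sup>2 / 2))" for t
    have w [measurable]: "w \<in> borel_measurable borel" unfolding w_def by measurable
    have w' [measurable]: "w \<in> borel_measurable lebesgue" using w by (intro measurable_completion) simp
    have wint: "integrable lborel w"
      using integrable_mult_cis [OF fourier_gaussian(1) [OF s], of "\<lambda>t. - (t * x)"]
      by (simp add: w_def [abs_def] mult.commute)
    have wle: "norm (w t) \<le> 1" for t by (simp add: w_def norm_mult)
    have "(\<integral>\<^sup>+ t. ennreal ((norm (w t))\<^sup>2) \<partial>lebesgue) \<le> (\<integral>\<^sup>+ t. ennreal (norm (w t)) \<partial>lborel)"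
      unfolding nn_integral_completion
      using wle by (intro nn_integral_mono ennreal_leI) (auto simp: power2_eq_square mult_left_le)
    also have "\<dots> < \<infinity>" using wint by (simp add: integrable_iff_bounded)
    finally have w2: "(\<integral>\<^sup>+ t. ennreal ((norm (w t))\<^sup>2) \<partial>lebesgue) < \<infinity>" .
    have lim0: "(\<lambda>n. LINT t|lebesgue. (F n t - g t) * w t) \<longlonglongrightarrow> 0"
    proof (rule integral_product_tendsto_0 [OF _ w' _ w2])
      show "(\<lambda>n. \<integral>\<^sup>+ t. ennreal ((norm (F n t - g t))\<^sup>2) \<partial>lebesgue) \<longlonglongrightarrow> 0"
        unfolding F_def by (rule filterlim_compose [OF lim filterlim_real_sequentially])
    qed measurable
    have eq: "(LINT t|lebesgue. (F n t - g t) * w t)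
        = 2 * pi * (LINT y|lborel. cutoff (real n) h y * complex_of_real (normal_density x s y)) - (LINT t|lebesgue. g t * w t)" for n
    proof -
      have Fle: "norm (F n t) \<le> (LINT x|lborel. norm (cutoff (real n) h x))" for t
        unfolding F_def by (intro norm_fourier_le integrable_cutoff h)
      have "integrable lborel (\<lambda>t. F n t * w t)"
      proof (rule Bochner_Integration.integrable_bound)
        show "integrable lborel (\<lambda>t. complex_of_real (LINT x|lborel. norm (cutoff (real n) h x)) * w t)"
          using wint by (rule integrable_mult_right)
        show "AE t in lborel. norm (F n t * w t) \<le> norm (complex_of_real (LINT x|lborel. norm (cutoff (real n) h x)) * w t)"
          using Fle by (auto simp: norm_mult intro!: mult_right_mono order_trans [OF _ abs_ge_self])
      qed measurable
      then have 1: "integrable lebesgue (\<lambda>t. F n t * w t)"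
        by (subst integrable_completion) auto
      have 2: "integrable lebesgue (\<lambda>t. g t * w t)"
        by (rule Bochner_Integration.integrable_bound [OF gint]) (use wle in \<open>auto simp: norm_mult mult_left_le\<close>)
      have "(LINT t|lebesgue. (F n t - g t) * w t) = (LINT t|lebesgue. F n t * w t) - (LINT t|lebesgue. g t * w t)"
        unfolding left_diff_distrib by (rule Bochner_Integration.integral_diff [OF 1 2])
      also have "(LINT t|lebesgue. F n t * w t) = (LINT t|lborel. F n t * w t)"
        by (rule integral_completion) measurable
      also have "\<dots> = 2 * pi * (LINT y|lborel. cutoff (real n) h y * complex_of_real (normal_density x s y))"
        using fourier_gaussian_inversion [OF integrable_cutoff [OF h] s, of "real n" x]
        by (simp add: F_def w_def mult.assoc)
      finally show ?thesis .
    qed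
    have "(\<lambda>n. LINT y|lborel. cutoff (real n) h y * complex_of_real (normal_density x s y))
        \<longlonglongrightarrow> (LINT y|lborel. h y * complex_of_real (normal_density x s y))"
    proof (rule integral_dominated_convergence [where w = "\<lambda>y. norm (h y * complex_of_real (normal_density x s y))"])
      show "AE y in lborel. (\<lambda>n. cutoff (real n) h y * complex_of_real (normal_density x s y))
          \<longlonglongrightarrow> h y * complex_of_real (normal_density x s y)"
      proof (intro AE_I2 tendsto_eventually)
        fix y
        show "eventually (\<lambda>n. cutoff (real n) h y * complex_of_real (normal_density x s y)
            = h y * complex_of_real (normal_density x s y)) sequentially"
          using eventually_ge_at_top [of "nat \<lceil>\<bar>y\<bar>\<rceil>"]
        proof eventually_elim
          case (elim n)
          then have "\<bar>y\<bar> \<le> real n" by linarith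
          then show ?case by (auto simp: cutoff_def indicator_def abs_le_iff)
        qed
      qed
    qed (use integrable_norm [OF integrable_L2_normal_density [OF h s, of x]] in \<open>auto simp: cutoff_def norm_mult indicator_def\<close>)
    then have "(\<lambda>n. 2 * pi * (LINT y|lborel. cutoff (real n) h y * complex_of_real (normal_density x s y)) - (LINT t|lebesgue. g t * w t))
        \<longlonglongrightarrow> 2 * pi * (LINT y|lborel. h y * complex_of_real (normal_density x s y)) - (LINT t|lebesgue. g t * w t)"
      by (intro tendsto_diff tendsto_mult tendsto_const)
    \<comment> \<open>By \<open>eq\<close> the sequence of \<open>lim0\<close>, with limit 0, is the
      one whose limit was just computed as a difference of the two sides.\<close>
    from LIMSEQ_unique [OF this lim0 [unfolded eq]] show ?thesis unfolding w_def by simp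
  qed
  define s where "s n = inverse (real (Suc n))" for n
  have s: "s n > 0" for n by (simp add: s_def)
  have s0: "s \<longlonglongrightarrow> 0" unfolding s_def by (rule LIMSEQ_inverse_real_of_nat)
  have "(\<lambda>n. LINT t|lebesgue. g t * (cis (- (t * x)) * complex_of_real (exp (- (s n * t)\<^sup>2 / 2))))
      \<longlonglongrightarrow> (LINT t|lebesgue. g t * cis (- (t * x)))"
  proof (rule integral_dominated_convergence [where w = "\<lambda>t. norm (g t)"])
    show "AE t in lebesgue. (\<lambda>n. g t * (cis (- (t * x)) * complex_of_real (exp (- (s n * t)\<^sup>2 / 2))))
        \<longlonglongrightarrow> g t * cis (- (t * x))"
    proof (intro AE_I2)
      fix t
      have "(\<lambda>n. g t * (cis (- (t * x)) * complex_of_real (exp (- (s n * t)\<^sup>2 / 2))))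
        \<longlonglongrightarrow> g t * (cis (- (t * x)) * complex_of_real (exp (- (0 * t)\<^sup>2 / 2)))"
        by (intro tendsto_intros s0) auto
      then show "(\<lambda>n. g t * (cis (- (t * x)) * complex_of_real (exp (- (s n * t)\<^sup>2 / 2))))
        \<longlonglongrightarrow> g t * cis (- (t * x))" by simp
    qed
    show "(\<lambda>t. g t * (cis (- (t * x)) * complex_of_real (exp (- (s n * t)\<^sup>2 / 2)))) \<in> borel_measurable lebesgue" for n
      by (intro borel_measurable_times g measurable_completion) measurable
    show "(\<lambda>t. g t * cis (- (t * x))) \<in> borel_measurable lebesgue"
      by (intro borel_measurable_times g measurable_completion) measurable
  qed (use gint in \<open>auto simp: norm_mult mult_left_le\<close>)
  then have 1: "(\<lambda>n. 2 * pi * (LINT y|lborel. h y * complex_of_real (normal_density x (s n) y)))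
      \<longlonglongrightarrow> (LINT t|lebesgue. g t * cis (- (t * x)))"
    by (simp only: gauss [OF s])
  have 2: "(\<lambda>n. 2 * pi * (LINT y|lborel. h y * complex_of_real (normal_density x (s n) y))) \<longlonglongrightarrow> 2 * pi * h x"
    by (rule tendsto_mult [OF tendsto_const normal_density_approximate_identity [OF h cont s0 s]])
  show ?thesis by (rule LIMSEQ_unique [OF 1 2])
qed

text \<open>Expanding the exponential and integrating term by term yields a power series about 0
  that converges everywhere: where \<open>g\<close> is nonzero, \<open>\<bar>t\<bar> <= T\<close>,
  so the n-th term is dominated by \<open>norm (g t) * (T * norm z) ^ n / fact n\<close>.\<close>

lemma fourier_laplace_entire:
  fixes g :: "real \<Rightarrow> complex"
  assumes g: "integrable lebesgue g" and supp: "\<And>t. \<bar>t\<bar> > T \<Longrightarrow> g t = 0"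
  defines "G \<equiv> \<lambda>z. LINT t|lebesgue. g t * exp (- (\<i> * complex_of_real t * z))"
  shows "G holomorphic_on UNIV"
    and "norm (G z) \<le> (LINT t|lebesgue. norm (g t)) * exp (T * \<bar>Im z\<bar>)"
proof -
  have g_meas: "g \<in> borel_measurable lebesgue" using g by auto
  have meas: "(\<lambda>t. g t * f t) \<in> borel_measurable lebesgue" if "f \<in> borel_measurable borel" for f
    using that by (intro borel_measurable_times g_meas measurable_completion) auto
  define a where "a n = (LINT t|lebesgue. g t * ((- \<i> * complex_of_real t) ^ n /\<^sub>R fact n))" for n
  have sums: "(\<lambda>n. a n * z ^ n) sums G z" for z
  proof -
    let ?f = "\<lambda>n t. g t * ((- \<i> * complex_of_real t * z) ^ n /\<^sub>R fact n)"
    have le: "norm (?f n t) \<le> norm (g t) * ((T * norm z) ^ n /\<^sub>R fact n)" for n t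
    proof (cases "\<bar>t\<bar> > T")
      case False
      then show ?thesis
        by (auto simp: norm_mult norm_power intro!: mult_left_mono divide_right_mono power_mono mult_right_mono)
    qed (simp add: supp)
    have int: "integrable lebesgue (?f n)" for n
    proof (rule Bochner_Integration.integrable_bound)
      show "integrable lebesgue (\<lambda>t. norm (g t) * ((T * norm z) ^ n /\<^sub>R fact n))"
        using g by (intro integrable_mult_left integrable_norm)
      show "AE t in lebesgue. norm (?f n t) \<le> norm (norm (g t) * ((T * norm z) ^ n /\<^sub>R fact n))"
        using le by (intro AE_I2) (metis abs_ge_self order_trans real_norm_def)
      show "?f n \<in> borel_measurable lebesgue" by (rule meas) measurable
    qed
    have summable: "summable (\<lambda>n. norm (?f n t))" for t
      unfolding norm_mult by (intro summable_mult summable_norm_exp)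
    have "(\<lambda>n. integral\<^sup>L lebesgue (?f n)) sums (LINT t|lebesgue. (\<Sum>n. ?f n t))"
    proof (rule sums_integral [OF int])
      show "AE t in lebesgue. summable (\<lambda>n. norm (?f n t))" using summable by simp
      show "summable (\<lambda>n. LINT t|lebesgue. norm (?f n t))"
      proof (rule summable_comparison_test')
        show "summable (\<lambda>n. (LINT t|lebesgue. norm (g t)) * ((T * norm z) ^ n /\<^sub>R fact n))"
          by (intro summable_mult summable_exp_generic)
        fix n :: nat
        have "norm (LINT t|lebesgue. norm (?f n t)) = (LINT t|lebesgue. norm (?f n t))" by simp
        also have "\<dots> \<le> (LINT t|lebesgue. norm (g t) * ((T * norm z) ^ n /\<^sub>R fact n))"
          using g by (intro integral_mono integrable_norm int le integrable_mult_left)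
        also have "\<dots> = (LINT t|lebesgue. norm (g t)) * ((T * norm z) ^ n /\<^sub>R fact n)"
          by (rule integral_mult_left_zero)
        finally show "norm (LINT t|lebesgue. norm (?f n t))
            \<le> (LINT t|lebesgue. norm (g t)) * ((T * norm z) ^ n /\<^sub>R fact n)" .
      qed
    qed
    also have "(\<lambda>n. integral\<^sup>L lebesgue (?f n)) = (\<lambda>n. a n * z ^ n)"
    proof
      fix n
      have "?f n = (\<lambda>t. g t * ((- \<i> * complex_of_real t) ^ n /\<^sub>R fact n) * z ^ n)"
        by (simp only: power_mult_distrib [of _ z]) (simp only: scaleR_conv_of_real mult_ac)
      then show "integral\<^sup>L lebesgue (?f n) = a n * z ^ n"
        unfolding a_def by (simp only: integral_mult_left_zero)
    qed
    also have "(\<lambda>t. \<Sum>n. ?f n t) = (\<lambda>t. g t * exp (- (\<i> * complex_of_real t * z)))"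
    proof
      fix t
      have "- \<i> * complex_of_real t * z = - (\<i> * complex_of_real t * z)" by simp
      then show "(\<Sum>n. ?f n t) = g t * exp (- (\<i> * complex_of_real t * z))"
        by (simp only: sums_unique [OF sums_mult [OF exp_converges], symmetric])
    qed
    finally show ?thesis unfolding G_def .
  qed
  have "G holomorphic_on ball 0 r" for r
    by (rule power_series_holomorphic [where a = a]) (use sums in simp)
  then have "G field_differentiable at z" for z
    by (rule holomorphic_on_imp_differentiable_at [of _ "ball 0 (norm z + 1)"]) auto
  then show "G holomorphic_on UNIV"
    by (simp add: holomorphic_on_def field_differentiable_at_within)
  have le: "norm (g t * exp (- (\<i> * complex_of_real t * z))) \<le> norm (g t) * exp (T * \<bar>Im z\<bar>)" for t
  proof (cases "\<bar>t\<bar> > T")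
    case False
    then have "\<bar>t * Im z\<bar> \<le> T * \<bar>Im z\<bar>" by (simp add: abs_mult mult_right_mono)
    then show ?thesis by (auto simp: norm_mult intro!: mult_left_mono)
  qed (simp add: supp)
  have int2: "integrable lebesgue (\<lambda>t. norm (g t) * exp (T * \<bar>Im z\<bar>))"
    using g by (intro integrable_mult_left integrable_norm)
  have "integrable lebesgue (\<lambda>t. g t * exp (- (\<i> * complex_of_real t * z)))"
  proof (rule Bochner_Integration.integrable_bound [OF int2])
    show "AE t in lebesgue. norm (g t * exp (- (\<i> * complex_of_real t * z))) \<le> norm (norm (g t) * exp (T * \<bar>Im z\<bar>))"
      using le by (intro AE_I2) (metis abs_ge_self order_trans real_norm_def)
    show "(\<lambda>t. g t * exp (- (\<i> * complex_of_real t * z))) \<in> borel_measurable lebesgue" by (rule meas) measurable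
  qed
  then have "norm (G z) \<le> (LINT t|lebesgue. norm (g t) * exp (T * \<bar>Im z\<bar>))"
    unfolding G_def by (rule Bochner_Integration.integral_norm_bound_integral [OF _ int2 le])
  then show "norm (G z) \<le> (LINT t|lebesgue. norm (g t)) * exp (T * \<bar>Im z\<bar>)" by simp
qed

text \<open>Bounded support makes the square-integrable transform integrable. Its Fourier-Laplace
  integral is then entire, and the inversion theorem identifies the values on the real axis with
  \<open>h\<close>.\<close>

theorem paley_wiener_extension:
  fixes g h :: "real \<Rightarrow> complex"
  assumes h: "h \<in> L2" and cont: "continuous_on UNIV h"
    and g: "g \<in> borel_measurable lebesgue" "(\<integral>\<^sup>+ t. ennreal ((norm (g t))\<^sup>2) \<partial>lebesgue) < \<infinity>"
    and supp: "AE t in lebesgue. \<bar>t\<bar> > T \<longrightarrow> g t = 0"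
    and lim: "((\<lambda>R. \<integral>\<^sup>+ t. ennreal ((norm (fourier (cutoff R h) t - g t))\<^sup>2) \<partial>lebesgue) \<longlongrightarrow> 0) at_top"
  obtains G C where "G holomorphic_on UNIV" "C > 0"
    "\<And>z. norm (G z) \<le> C * exp (T * \<bar>Im z\<bar>)" "\<And>x. G (complex_of_real x) = h x"
proof -
  \<comment> \<open>This representative vanishes everywhere outside the interval, not just almost
    everywhere, as the pointwise estimates of \<open>fourier_laplace_entire\<close> require.\<close>
  define k where "k t = indicator {-T..T} t *\<^sub>R g t" for t
  have k_meas: "k \<in> borel_measurable lebesgue"
    unfolding k_def by (intro borel_measurable_scaleR g(1) measurable_completion) measurable
  have ae: "AE t in lebesgue. k t = g t"
    using supp by eventually_elim (auto simp: k_def indicator_def abs_less_iff not_le)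
  have k_int: "integrable lebesgue k"
  proof (rule Bochner_Integration.integrable_bound)
    have "integrable lebesgue (\<lambda>t. (norm (g t))\<^sup>2)"
      using g by (intro integrableI_bounded) auto
    then show "integrable lebesgue (\<lambda>t. indicator {-T..T} t + (norm (g t))\<^sup>2)"
      by (intro Bochner_Integration.integrable_add) (auto simp: emeasure_lborel_Icc_eq)
    show "AE t in lebesgue. norm (k t) \<le> norm (indicator {-T..T} t + (norm (g t))\<^sup>2)"
      by (auto simp: k_def indicator_def le_one_plus_power2)
  qed (rule k_meas)
  have "(\<integral>\<^sup>+ t. ennreal ((norm (fourier (cutoff R h) t - g t))\<^sup>2) \<partial>lebesgue)
      = (\<integral>\<^sup>+ t. ennreal ((norm (fourier (cutoff R h) t - k t))\<^sup>2) \<partial>lebesgue)" for R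
    by (rule nn_integral_cong_AE) (use ae in eventually_elim, simp)
  with lim have lim': "((\<lambda>R. \<integral>\<^sup>+ t. ennreal ((norm (fourier (cutoff R h) t - k t))\<^sup>2) \<partial>lebesgue) \<longlongrightarrow> 0) at_top"
    by simp
  define G where "G z = (LINT t|lebesgue. k t * exp (- (\<i> * complex_of_real t * z)))" for z
  have ksupp: "k t = 0" if "\<bar>t\<bar> > T" for t using that by (auto simp: k_def indicator_def)
  define I where "I = (LINT t|lebesgue. norm (k t))"
  have entire: "G holomorphic_on UNIV" "norm (G z) \<le> I * exp (T * \<bar>Im z\<bar>)" for z
    unfolding G_def I_def by (rule fourier_laplace_entire [OF k_int ksupp]; assumption)+
  have I: "I \<ge> 0" by (simp add: I_def)
  \<comment> \<open>The constant \<open>I + 1\<close> is strictly positive even if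
    \<open>I = 0\<close>; division by \<open>2 * pi\<close> only decreases the norm.\<close>
  show ?thesis
  proof (rule that [of "\<lambda>z. G z / (2 * pi)" "I + 1"])
    show "(\<lambda>z. G z / (2 * pi)) holomorphic_on UNIV"
      using entire(1) by (intro holomorphic_intros) auto
    show "I + 1 > 0" using I by simp
    show "norm (G z / (2 * pi)) \<le> (I + 1) * exp (T * \<bar>Im z\<bar>)" for z
    proof -
      have "norm (G z / (2 * pi)) \<le> norm (G z) / 1"
        unfolding norm_divide using pi_ge_two by (intro divide_left_mono) auto
      also have "\<dots> \<le> I * exp (T * \<bar>Im z\<bar>)" using entire(2) [of z] by simp
      also have "\<dots> \<le> (I + 1) * exp (T * \<bar>Im z\<bar>)" by (intro mult_right_mono) auto
      finally show ?thesis .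
    qed
    show "G (complex_of_real x) / (2 * pi) = h x" for x
    proof -
      have "isCont h x" using cont by (simp add: continuous_on_eq_continuous_at)
      from fourier_inversion_L2 [OF h this k_meas k_int lim']
      show ?thesis by (simp add: G_def cis_conv_exp mult_ac)
    qed
  qed
qed

section \<open>Mellin transform and polar analyticity in exponential coordinates\<close>

text \<open>The factor \<open>exp (c * x)\<close> absorbs the weight of
  \<open>mellin_space 2 c\<close>, so that its norm becomes the ordinary square norm on the
  line.\<close>

definition exp_lift :: "real \<Rightarrow> (real \<Rightarrow> complex) \<Rightarrow> real \<Rightarrow> complex" where
  "exp_lift c \<phi> x = complex_of_real (exp (c * x)) * \<phi> (exp x)"

lemma continuous_on_exp_lift:
  assumes "continuous_on {0<..} \<phi>"
  shows "continuous_on UNIV (exp_lift c \<phi>)"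
  unfolding exp_lift_def
  by (intro continuous_intros continuous_on_compose2 [OF assms]) auto

text \<open>The substitution \<open>u = exp x\<close> maps the interval from
  \<open>- ln \<rho>\<close> to \<open>ln \<rho>\<close> onto the Mellin range, which is why the
  symmetric cutoff is the right one. Continuity of \<open>\<phi>\<close> justifies the substitution
  and the change from Lebesgue to Borel measure.\<close>

lemma truncated_mellin_eq_fourier:
  assumes cont: "continuous_on {0<..} \<phi>" and \<rho>: "\<rho> \<ge> 1"
  shows "truncated_mellin c \<phi> \<rho> t = fourier (cutoff (ln \<rho>) (exp_lift c \<phi>)) t"
proof -
  define R where "R = ln \<rho>"
  have R: "R \<ge> 0" "exp R = \<rho>" "exp (- R) = 1 / \<rho>"
    using \<rho> by (auto simp: R_def exp_minus divide_inverse)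
  have "exp (- R) \<le> exp R" using R(1) by simp
  then have le: "1 / \<rho> \<le> \<rho>" by (simp only: R(2,3))
  have "0 < 1 / \<rho>" using \<rho> by simp
  then have sub: "{1 / \<rho>..\<rho>} \<subseteq> {0<..}" by (meson atLeastAtMost_iff greaterThan_iff order.strict_trans2 subsetI)
  let ?f = "\<lambda>u. \<phi> u * complex_of_real u powr (Complex c t - 1)"
  have contf: "continuous_on {1 / \<rho>..\<rho>} ?f"
    using sub
    by (intro continuous_intros continuous_on_subset [OF cont]) (auto simp: complex_nonpos_Reals_iff)
  have "truncated_mellin c \<phi> \<rho> t = (LINT u|lebesgue. indicator {1 / \<rho>..\<rho>} u *\<^sub>R ?f u)"
    unfolding truncated_mellin_def set_lebesgue_integral_def ..
  also have "\<dots> = (LINT u|lborel. indicator {1 / \<rho>..\<rho>} u *\<^sub>R ?f u)"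
    using borel_measurable_continuous_on_indicator [OF _ contf] by (intro integral_completion) simp
  also have "\<dots> = (LBINT u = exp (- R)..exp R. ?f u)"
    using interval_integral_Icc [OF le, of ?f] by (simp only: R(2,3) set_lebesgue_integral_def)
  also have "\<dots> = (LBINT x = - R..R. exp x *\<^sub>R ?f (exp x))"
  proof (rule interval_integral_substitution_finite [symmetric])
    have "exp ` {- R..R} \<subseteq> {exp (- R)..exp R}" by auto
    then have "exp ` {- R..R} \<subseteq> {1 / \<rho>..\<rho>}" by (simp only: R(2,3))
    then show "continuous_on (exp ` {- R..R}) ?f" by (rule continuous_on_subset [OF contf])
  qed (use R in \<open>auto intro!: derivative_eq_intros continuous_intros\<close>)
  also have "\<dots> = (LINT x|lborel. indicator {- R..R} x *\<^sub>R (exp x *\<^sub>R ?f (exp x)))"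
    using R by (subst interval_integral_Icc) (auto simp: set_lebesgue_integral_def)
  also have "\<dots> = fourier (cutoff R (exp_lift c \<phi>)) t"
    unfolding fourier_def
  proof (intro Bochner_Integration.integral_cong refl)
    fix x
    have "complex_of_real (exp x) powr (Complex c t - 1) = exp ((Complex c t - 1) * complex_of_real x)"
      by (simp add: powr_def Ln_of_real)
    then have "exp x *\<^sub>R ?f (exp x) = \<phi> (exp x) * (exp (complex_of_real x) * exp ((Complex c t - 1) * complex_of_real x))"
      by (simp add: scaleR_conv_of_real exp_of_real)
    \<comment> \<open>The Jacobian \<open>exp x\<close> cancels the \<open>- 1\<close> in the Mellin
      exponent.\<close>
    also have "exp (complex_of_real x) * exp ((Complex c t - 1) * complex_of_real x) = exp (Complex (c * x) (t * x))"
    proof -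
      have "complex_of_real x + (Complex c t - 1) * complex_of_real x = Complex (c * x) (t * x)"
        by (simp add: complex_eq_iff algebra_simps)
      then show ?thesis by (simp only: exp_add [symmetric])
    qed
    also have "\<dots> = complex_of_real (exp (c * x)) * cis (t * x)"
      by (simp add: exp_eq_polar)
    finally show "indicator {- R..R} x *\<^sub>R (exp x *\<^sub>R ?f (exp x)) = cutoff R (exp_lift c \<phi>) x * cis (t * x)"
      by (simp add: cutoff_def exp_lift_def mult_ac)
  qed
  finally show ?thesis unfolding R_def .
qed

text \<open>The substitution \<open>r = exp x\<close> is made on \<open>[-n, n]\<close>, with a
  bound that does not depend on \<open>n\<close>; monotone convergence then gives the whole
  line.\<close>

lemma L2_exp_lift:
  assumes \<phi>: "\<phi> \<in> mellin_space 2 c" and cont: "continuous_on {0<..} \<phi>"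
  shows "exp_lift c \<phi> \<in> L2"
proof -
  let ?h = "exp_lift c \<phi>"
  have h [measurable]: "?h \<in> borel_measurable borel"
    by (intro borel_measurable_continuous_onI continuous_on_exp_lift cont)
  define p where "p r = (norm (\<phi> r))\<^sup>2 * r powr (c * 2 - 1)" for r
  have contp: "continuous_on {0<..} p"
    unfolding p_def by (intro continuous_intros cont) auto
  let ?A = "\<integral>\<^sup>+ r. ennreal (p r) \<partial>lebesgue_on {0<..}"
  have A: "?A = (\<integral>\<^sup>+ r. ennreal (p r) * indicator {0<..} r \<partial>lborel)"
    by (subst nn_integral_restrict_space) (auto simp: nn_integral_completion)
  have "(\<integral>\<^sup>+ x. ennreal ((norm (?h x))\<^sup>2) * indicator {- real n..real n} x \<partial>lborel) \<le> ?A" for n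
  proof -
    have "(\<integral>\<^sup>+ x. ennreal ((norm (?h x))\<^sup>2) * indicator {- real n..real n} x \<partial>lborel)
        = (\<integral>\<^sup>+ x. ennreal (p (exp x) * exp x * indicator {- real n..real n} x) \<partial>lborel)"
    proof (intro nn_integral_cong)
      fix x
      have "exp x powr (c * 2 - 1) * exp x = (exp (c * x))\<^sup>2"
        by (simp add: powr_def algebra_simps flip: exp_add exp_double)
      then have "(norm (?h x))\<^sup>2 = p (exp x) * exp x"
        by (simp add: p_def exp_lift_def norm_mult power_mult_distrib)
      then show "ennreal ((norm (?h x))\<^sup>2) * indicator {- real n..real n} x
          = ennreal (p (exp x) * exp x * indicator {- real n..real n} x)"
        by (simp add: indicator_def)
    qed
    also have "\<dots> = (\<integral>\<^sup>+ r. ennreal (p r * indicator {exp (- real n)..exp (real n)} r) \<partial>lborel)"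
    proof (rule nn_integral_substitution [symmetric])
      have "{exp (- real n)..exp (real n)} \<subseteq> {0<..}" by (auto intro: order.strict_trans2 [OF exp_gt_zero])
      then show "set_borel_measurable borel {exp (- real n)..exp (real n)} p"
        unfolding set_borel_measurable_def
        by (intro borel_measurable_continuous_on_indicator continuous_on_subset [OF contp]) auto
    qed (auto intro!: derivative_eq_intros continuous_intros)
    also have "\<dots> \<le> ?A"
      unfolding A by (intro nn_integral_mono) (auto simp: indicator_def intro: order.strict_trans2 [OF exp_gt_zero])
    finally show ?thesis .
  qed
  moreover have "(\<integral>\<^sup>+ x. ennreal ((norm (?h x))\<^sup>2) \<partial>lborel)
      = (SUP n. \<integral>\<^sup>+ x. ennreal ((norm (?h x))\<^sup>2) * indicator {- real n..real n} x \<partial>lborel)"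
  proof -
    have "(\<integral>\<^sup>+ x. ennreal ((norm (?h x))\<^sup>2) \<partial>lborel)
      = (\<integral>\<^sup>+ x. (SUP n. ennreal ((norm (?h x))\<^sup>2) * indicator {- real n..real n} x) \<partial>lborel)"
    proof (intro nn_integral_cong antisym SUP_least)
      fix x
      have "x \<in> {- real (nat \<lceil>\<bar>x\<bar>\<rceil>)..real (nat \<lceil>\<bar>x\<bar>\<rceil>)}"
        unfolding atLeastAtMost_iff by linarith
      then show "ennreal ((norm (?h x))\<^sup>2) \<le> (SUP n. ennreal ((norm (?h x))\<^sup>2) * indicator {- real n..real n} x)"
        by (intro SUP_upper2 [of "nat \<lceil>\<bar>x\<bar>\<rceil>"]) (simp_all only: indicator_simps(1) mult_1_right order_refl UNIV_I)
    qed (auto simp: indicator_def)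
    also have "\<dots> = (SUP n. \<integral>\<^sup>+ x. ennreal ((norm (?h x))\<^sup>2) * indicator {- real n..real n} x \<partial>lborel)"
      by (rule nn_integral_monotone_convergence_SUP) (auto simp: incseq_def le_fun_def indicator_def)
    finally show ?thesis .
  qed
  moreover have "?A < \<infinity>" using \<phi> by (simp add: mellin_space_def p_def)
  ultimately show ?thesis
    using h by (auto simp: L2_def intro!: order.strict_trans1 [OF SUP_least])
qed

section \<open>Polar analyticity in logarithmic coordinates\<close>

lemma rcis_eq_exp: "r > 0 \<Longrightarrow> rcis r \<theta> = exp (Complex (ln r) \<theta>)"
  by (simp add: rcis_def exp_eq_polar)

lemma exp_difference_quotient:
  "((\<lambda>w. (exp w - exp z) / (w - z)) \<longlongrightarrow> exp z) (at (z :: complex))"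
  using DERIV_exp [of z] by (simp add: has_field_derivative_iff)

text \<open>In the coordinates \<open>z = ln r + i \<theta>\<close> the denominator of the polar
  quotient is \<open>exp z - exp z0\<close>. Multiplying by the difference quotient of
  \<open>exp\<close>, which tends to \<open>exp z0\<close>, turns it into an ordinary complex
  derivative.\<close>

lemma polar_analytic_imp_holomorphic:
  assumes "polar_analytic_on f polar_plane"
  shows "(\<lambda>z. f (exp (Re z), Im z)) holomorphic_on UNIV"
proof -
  let ?F = "\<lambda>z. f (exp (Re z), Im z)"
  have "?F field_differentiable at z0" for z0
  proof -
    let ?p = "\<lambda>z. (exp (Re z), Im z)"
    have p_in: "?p z \<in> polar_plane" for z by (simp add: polar_plane_def)
    obtain L where L: "((\<lambda>(r, \<theta>). (f (r, \<theta>) - f (?p z0)) / (rcis r \<theta> - rcis (exp (Re z0)) (Im z0))) \<longlongrightarrow> L)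
          (at (?p z0) within polar_plane)"
      using assms p_in [of z0] unfolding polar_analytic_on_def by fastforce
    have "filterlim ?p (at (?p z0) within polar_plane) (at z0)"
      unfolding filterlim_at
    proof
      show "eventually (\<lambda>z. ?p z \<in> polar_plane \<and> ?p z \<noteq> ?p z0) (at z0)"
        by (auto simp: eventually_at_filter p_in complex_eq_iff intro!: always_eventually)
      show "(?p \<longlongrightarrow> ?p z0) (at z0)" by (intro tendsto_intros)
    qed
    from filterlim_compose [OF L this]
    have "((\<lambda>z. (?F z - ?F z0) / (exp z - exp z0)) \<longlongrightarrow> L) (at z0)"
      by (simp add: rcis_eq_exp)
    from tendsto_mult [OF this exp_difference_quotient [of z0]]
    have lim: "((\<lambda>z. (?F z - ?F z0) / (exp z - exp z0) * ((exp z - exp z0) / (z - z0))) \<longlongrightarrow> L * exp z0) (at z0)" .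
    \<comment> \<open>The exponential is not injective, but its difference quotient has the nonzero
      limit \<open>exp z0\<close>; hence \<open>exp z\<close> differs from \<open>exp z0\<close>
      near \<open>z0\<close>, and the cancellation is legitimate there.\<close>
    have "eventually (\<lambda>z. (exp z - exp z0) / (z - z0) \<noteq> 0) (at z0)"
      by (rule tendsto_imp_eventually_ne [OF exp_difference_quotient]) simp
    then have "eventually (\<lambda>z. (?F z - ?F z0) / (exp z - exp z0) * ((exp z - exp z0) / (z - z0))
        = (?F z - ?F z0) / (z - z0)) (at z0)"
      by eventually_elim simp
    with lim have "((\<lambda>z. (?F z - ?F z0) / (z - z0)) \<longlongrightarrow> L * exp z0) (at z0)"
      by (rule Lim_transform_eventually)
    then show ?thesis
      unfolding field_differentiable_def has_field_derivative_iff by blast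
  qed
  then show ?thesis by (simp add: holomorphic_on_def)
qed

lemma holomorphic_imp_polar_analytic:
  assumes F: "F holomorphic_on UNIV"
  shows "polar_analytic_on (\<lambda>(r, \<theta>). F (Complex (ln r) \<theta>)) polar_plane"
proof -
  let ?q = "\<lambda>p. Complex (ln (fst p)) (snd p)"
  have "\<exists>L. ((\<lambda>p. (F (?q p) - F (?q (r0, \<theta>0))) / (rcis (fst p) (snd p) - rcis r0 \<theta>0)) \<longlongrightarrow> L)
      (at (r0, \<theta>0) within polar_plane)" if in0: "(r0, \<theta>0) \<in> polar_plane" for r0 \<theta>0 :: real
  proof -
    have r0: "r0 > 0" using in0 by (simp add: polar_plane_def)
    define z0 where "z0 = Complex (ln r0) \<theta>0"
    have "(F has_field_derivative deriv F z0) (at z0)"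
      using F by (intro holomorphic_derivI [of _ UNIV]) auto
    then have "((\<lambda>w. (F w - F z0) / (w - z0)) \<longlongrightarrow> deriv F z0) (at z0)"
      by (simp add: has_field_derivative_iff)
    from tendsto_divide [OF this exp_difference_quotient [of z0]]
    have "((\<lambda>w. (F w - F z0) / (w - z0) / ((exp w - exp z0) / (w - z0))) \<longlongrightarrow> deriv F z0 / exp z0) (at z0)"
      by simp
    \<comment> \<open>For \<open>w\<close> different from \<open>z0\<close> the factor
      \<open>w - z0\<close> cancels. Where \<open>exp w = exp z0\<close>, both sides are 0 by the
      convention on division by zero.\<close>
    moreover have "eventually (\<lambda>w. (F w - F z0) / (w - z0) / ((exp w - exp z0) / (w - z0))
        = (F w - F z0) / (exp w - exp z0)) (at z0)"
      by (simp add: eventually_at_filter)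
    ultimately have lim: "((\<lambda>w. (F w - F z0) / (exp w - exp z0)) \<longlongrightarrow> deriv F z0 / exp z0) (at z0)"
      by (rule Lim_transform_eventually)
    let ?at = "at (r0, \<theta>0) within polar_plane"
    have "filterlim ?q (at z0) ?at"
      unfolding filterlim_at
    proof
      \<comment> \<open>The punctured limit at \<open>z0\<close> needs \<open>?q\<close> to avoid
        \<open>z0\<close> at other points of the polar plane, which holds since \<open>ln\<close> is
        injective on the positive reals.\<close>
      show "eventually (\<lambda>p. ?q p \<in> UNIV \<and> ?q p \<noteq> z0) ?at"
        using r0 by (auto simp: eventually_at_filter z0_def polar_plane_def intro!: always_eventually)
      have fst: "(fst \<longlongrightarrow> r0) ?at" and snd: "(snd \<longlongrightarrow> \<theta>0) ?at"
        using tendsto_fst [OF tendsto_ident_at, of "(r0, \<theta>0)" polar_plane] tendsto_snd [OF tendsto_ident_at, of "(r0, \<theta>0)" polar_plane] by auto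
      then show "(?q \<longlongrightarrow> z0) ?at"
        unfolding z0_def using r0 by (intro tendsto_Complex tendsto_ln) auto
    qed
    from filterlim_compose [OF lim this]
    have "((\<lambda>p. (F (?q p) - F z0) / (exp (?q p) - exp z0)) \<longlongrightarrow> deriv F z0 / exp z0) ?at" .
    moreover have "eventually (\<lambda>p. (F (?q p) - F z0) / (exp (?q p) - exp z0)
        = (F (?q p) - F (?q (r0, \<theta>0))) / (rcis (fst p) (snd p) - rcis r0 \<theta>0)) ?at"
      using r0 by (auto simp: eventually_at_filter z0_def polar_plane_def rcis_eq_exp intro!: always_eventually)
    ultimately show ?thesis by (blast intro: Lim_transform_eventually)
  qed
  then show ?thesis by (auto simp: polar_analytic_on_def split_beta')
qed

section \<open>The equivalence for the Mellin spaces\<close>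

theorem theorem4:
  fixes c T :: real and \<phi> :: "real \<Rightarrow> complex"
  assumes "T > 0" and "\<phi> \<in> mellin_space 2 c"
  shows "\<phi> \<in> paley_wiener_space c T \<longleftrightarrow>
    (\<exists>f \<in> mellin_bernstein_space 2 c T. \<forall>r>0. f (r, 0) = \<phi> r)"
proof
  let ?h = "exp_lift c \<phi>"
  assume "\<phi> \<in> paley_wiener_space c T"
  then obtain g where cont: "continuous_on {0<..} \<phi>"
    and g: "g \<in> borel_measurable lebesgue" "(\<integral>\<^sup>+ t. ennreal ((norm (g t))\<^sup>2) \<partial>lebesgue) < \<infinity>"
    and mellin: "((\<lambda>\<rho>. \<integral>\<^sup>+ t. ennreal ((norm (truncated_mellin c \<phi> \<rho> t - g t))\<^sup>2) \<partial>lebesgue) \<longlongrightarrow> 0) at_top"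
    and supp: "AE t in lebesgue. \<bar>t\<bar> > T \<longrightarrow> g t = 0"
    by (auto simp: paley_wiener_space_def has_mellin_transform_def)
  have "((\<lambda>R. \<integral>\<^sup>+ t. ennreal ((norm (truncated_mellin c \<phi> (exp R) t - g t))\<^sup>2) \<partial>lebesgue) \<longlongrightarrow> 0) at_top"
    by (rule filterlim_compose [OF mellin exp_at_top])
  moreover have "eventually (\<lambda>R. (\<integral>\<^sup>+ t. ennreal ((norm (truncated_mellin c \<phi> (exp R) t - g t))\<^sup>2) \<partial>lebesgue)
      = (\<integral>\<^sup>+ t. ennreal ((norm (fourier (cutoff R ?h) t - g t))\<^sup>2) \<partial>lebesgue)) at_top"
    using eventually_ge_at_top [of 0]
    by eventually_elim (simp add: truncated_mellin_eq_fourier [OF cont])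
  ultimately have lim: "((\<lambda>R. \<integral>\<^sup>+ t. ennreal ((norm (fourier (cutoff R ?h) t - g t))\<^sup>2) \<partial>lebesgue) \<longlongrightarrow> 0) at_top"
    by (rule Lim_transform_eventually)
  obtain G C where G: "G holomorphic_on UNIV" and C: "C > 0"
    and bound: "\<And>z. norm (G z) \<le> C * exp (T * \<bar>Im z\<bar>)" and eq: "\<And>x. G (complex_of_real x) = ?h x"
    using paley_wiener_extension [OF L2_exp_lift [OF assms(2) cont] continuous_on_exp_lift [OF cont] g supp lim]
    by blast
  \<comment> \<open>\<open>G\<close> extends the weighted function, so the weight is divided out
    again; at \<open>ln r + i \<theta>\<close> the new factor has norm \<open>r powr (- c)\<close>,
    as the growth condition demands.\<close>
  define F where "F z = exp (- (complex_of_real c * z)) * G z" for z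
  define f where "f = (\<lambda>(r, \<theta>). F (Complex (ln r) \<theta>))"
  have f_eq: "f (r, 0) = \<phi> r" if "r > 0" for r
  proof -
    have "Complex (ln r) 0 = complex_of_real (ln r)" by (simp add: complex_eq_iff)
    then show ?thesis
      using that by (simp add: f_def F_def eq exp_lift_def exp_of_real flip: of_real_mult of_real_minus exp_add mult.assoc)
  qed
  have "F holomorphic_on UNIV"
    unfolding F_def using G by (intro holomorphic_intros)
  then have "polar_analytic_on f polar_plane"
    unfolding f_def by (rule holomorphic_imp_polar_analytic)
  moreover have "(\<lambda>r. f (r, 0)) \<in> mellin_space 2 c"
  proof -
    have "(\<lambda>r. f (r, 0)) \<in> borel_measurable (lebesgue_on {0<..}) \<longleftrightarrow> \<phi> \<in> borel_measurable (lebesgue_on {0<..})"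
      by (rule measurable_cong) (simp add: f_eq)
    moreover have "(\<integral>\<^sup>+ r. ennreal (norm (f (r, 0)) powr 2 * r powr (c * 2 - 1)) \<partial>lebesgue_on {0<..})
        = (\<integral>\<^sup>+ r. ennreal (norm (\<phi> r) powr 2 * r powr (c * 2 - 1)) \<partial>lebesgue_on {0<..})"
      by (rule nn_integral_cong) (simp add: f_eq)
    ultimately show ?thesis using assms(2) by (simp add: mellin_space_def)
  qed
  moreover have "norm (f (r, \<theta>)) \<le> C * r powr (- c) * exp (T * \<bar>\<theta>\<bar>)" if "r > 0" for r \<theta>
  proof -
    have "norm (f (r, \<theta>)) = r powr (- c) * norm (G (Complex (ln r) \<theta>))"
      using that by (simp add: f_def F_def norm_mult powr_def)
    also have "\<dots> \<le> r powr (- c) * (C * exp (T * \<bar>\<theta>\<bar>))"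
      using bound [of "Complex (ln r) \<theta>"] by (intro mult_left_mono) auto
    finally show ?thesis by (simp add: mult_ac)
  qed
  ultimately have "f \<in> mellin_bernstein_space 2 c T"
    using C unfolding mellin_bernstein_space_def polar_plane_def by blast
  then show "\<exists>f \<in> mellin_bernstein_space 2 c T. \<forall>r>0. f (r, 0) = \<phi> r"
    using f_eq by blast
next
  let ?h = "exp_lift c \<phi>"
  assume "\<exists>f \<in> mellin_bernstein_space 2 c T. \<forall>r>0. f (r, 0) = \<phi> r"
  then obtain f C where f: "polar_analytic_on f polar_plane" and f_eq: "\<And>r. r > 0 \<Longrightarrow> f (r, 0) = \<phi> r"
    and bound': "\<forall>(r, \<theta>)\<in>polar_plane. norm (f (r, \<theta>)) \<le> C * r powr (- c) * exp (T * \<bar>\<theta>\<bar>)"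
    unfolding mellin_bernstein_space_def by blast
  have bound: "norm (f (r, \<theta>)) \<le> C * r powr (- c) * exp (T * \<bar>\<theta>\<bar>)" if "r > 0" for r \<theta>
    using bound' that by (auto simp: polar_plane_def)
  define F where "F z = f (exp (Re z), Im z)" for z
  \<comment> \<open>The norm of \<open>exp (c * z)\<close> is \<open>exp (c * Re z)\<close>, which
    cancels the factor \<open>r powr (- c)\<close> at \<open>r = exp (Re z)\<close> and leaves pure
    exponential type in \<open>Im z\<close>.\<close>
  define G where "G z = exp (complex_of_real c * z) * F z" for z
  have "F holomorphic_on UNIV"
    unfolding F_def using f by (rule polar_analytic_imp_holomorphic)
  then have G: "G holomorphic_on UNIV"
    unfolding G_def by (intro holomorphic_intros)
  have G_real: "(\<lambda>x. G (complex_of_real x)) = ?h"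
    by (auto simp: G_def F_def exp_lift_def f_eq exp_of_real simp flip: of_real_mult)
  have G_bound: "norm (G z) \<le> C * exp (T * \<bar>Im z\<bar>)" for z
  proof -
    have "norm (G z) \<le> exp (c * Re z) * (C * exp (Re z) powr (- c) * exp (T * \<bar>Im z\<bar>))"
      unfolding G_def F_def norm_mult by (intro mult_mono bound) auto
    also have "\<dots> = C * exp (T * \<bar>Im z\<bar>)"
      by (simp add: powr_def exp_minus)
    finally show ?thesis .
  qed
  \<comment> \<open>Continuity of \<open>\<phi>\<close> comes from its extension: on the positive
    half-line \<open>\<phi> r\<close> is \<open>F\<close> at \<open>ln r\<close>.\<close>
  have "continuous_on UNIV F"
    using \<open>F holomorphic_on UNIV\<close> by (rule holomorphic_on_imp_continuous_on)
  then have "continuous_on {0<..} (\<lambda>r. F (complex_of_real (ln r)))"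
    by (rule continuous_on_compose2) (auto intro!: continuous_intros)
  then have cont: "continuous_on {0<..} \<phi>"
    by (rule continuous_on_eq) (simp add: F_def f_eq)
  obtain g where g: "g \<in> L2" "AE t in lborel. \<bar>t\<bar> > T \<longrightarrow> g t = 0"
    and lim: "((\<lambda>R. \<integral>\<^sup>+ t. ennreal ((norm (fourier (cutoff R ?h) t - g t))\<^sup>2) \<partial>lborel) \<longlongrightarrow> 0) at_top"
    using paley_wiener_transform [OF G G_bound, unfolded G_real] L2_exp_lift [OF assms(2) cont] by blast
  have "((\<lambda>\<rho>. \<integral>\<^sup>+ t. ennreal ((norm (fourier (cutoff (ln \<rho>) ?h) t - g t))\<^sup>2) \<partial>lborel) \<longlongrightarrow> 0) at_top"
    by (rule filterlim_compose [OF lim ln_at_top])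
  moreover have "eventually (\<lambda>\<rho>. (\<integral>\<^sup>+ t. ennreal ((norm (fourier (cutoff (ln \<rho>) ?h) t - g t))\<^sup>2) \<partial>lborel)
      = (\<integral>\<^sup>+ t. ennreal ((norm (truncated_mellin c \<phi> \<rho> t - g t))\<^sup>2) \<partial>lebesgue)) at_top"
    using eventually_ge_at_top [of 1]
    by eventually_elim (simp add: truncated_mellin_eq_fourier [OF cont] nn_integral_completion)
  ultimately have "((\<lambda>\<rho>. \<integral>\<^sup>+ t. ennreal ((norm (truncated_mellin c \<phi> \<rho> t - g t))\<^sup>2) \<partial>lebesgue) \<longlongrightarrow> 0) at_top"
    by (rule Lim_transform_eventually)
  then have "has_mellin_transform c \<phi> g"
    using g(1) by (auto simp: has_mellin_transform_def L2_def nn_integral_completion intro: measurable_completion)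
  moreover have "AE t in lebesgue. \<bar>t\<bar> > T \<longrightarrow> g t = 0"
    using g(2) by (rule AE_completion)
  ultimately show "\<phi> \<in> paley_wiener_space c T"
    using assms(2) cont by (auto simp: paley_wiener_space_def)
qed

end
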